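(* Let $\alpha>-1$. The von Neumann algebra $\mathcal{R}^{(\alpha)}$ consists of all operators $S\in\mathcal{B}(L^2(\mathbb{D},\mu_\alpha))$ that act invariantly on $\mathcal{W}_\xi^{(\alpha)}$ (that is, $S(\mathcal{W}_\xi^{(\alpha)})\subseteq\mathcal{W}_\xi^{(\alpha)}$) for every $\xi\in\mathbb{Z}$, and $\mathcal{R}^{(\alpha)}$ is isometrically isomorphic to $\bigoplus_{\xi\in\mathbb{Z}}\mathcal{B}(\mathcal{W}_\xi^{(\alpha)})$.
   Context: $\mathbb{N}_0=\{0,1,2,\dots\}$, $\mathbb{D}$ is the open unit disk, $\mathbb{T}$ the unit circle, and $\mathrm{d}\mu_\alpha(z)=\frac{\alpha+1}{\pi}(1-|z|^2)^\alpha\,\mathrm{d}\mu(z)$ on $\mathbb{D}$, where $\mu$ is Lebesgue plane measure. $\mathcal{B}(H)$ is the algebra of bounded linear operators on a Hilbert space $H$. For $\tau\in\mathbb{T}$, $\rho^{(\alpha)}(\tau)$ is the unitary rotation operator on $L^2(\mathbb{D},\mu_\alpha)$ given by $(\rho^{(\alpha)}(\tau)f)(z)=f(\tau^{-1}z)$. The algebra of radial operators is $$\mathcal{R}^{(\alpha)}=\{S\in\mathcal{B}(L^2(\mathbb{D},\mu_\alpha)):\ \rho^{(\alpha)}(\tau)S=S\rho^{(\alpha)}(\tau)\ \text{for all }\tau\in\mathbb{T}\}.$$ Put $m_{p,q}(z)=z^p\overline{z}^q$ for $p,q\in\mathbb{N}_0$. For $\xi\in\mathbb{Z}$, $\mathcal{W}_\xi^{(\alpha)}$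 is the closure in $L^2(\mathbb{D},\mu_\alpha)$ of $\operatorname{span}\{m_{p,q}:\ p,q\in\mathbb{N}_0,\ p-q=\xi\}$. The direct sum of W*-algebras consists of all families $(A_\xi)_\xi$ with $\sup_\xi\|A_\xi\|<\infty$, with componentwise operations and the supremum norm; isomorphism is meant as W*-algebras. *)

theory Defs
  imports "HOL-Analysis.Analysis" "HOL-Algebra.QuotRing" "HOL-Algebra.Module"
begin

section \<open>Operators on complex inner product spaces with an explicit carrier\<close>

record 'a inner_space =
  vecs :: "'a set"
  vadd :: "'a \<Rightarrow> 'a \<Rightarrow> 'a"
  vzero :: 'a
  vscale :: "complex \<Rightarrow> 'a \<Rightarrow> 'a"
  vinner :: "'a \<Rightarrow> 'a \<Rightarrow> complex"

definition vnorm :: "'a inner_space \<Rightarrow> 'a \<Rightarrow> real"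
  where "vnorm H x = sqrt (Re (vinner H x x))"

definition vdist :: "'a inner_space \<Rightarrow> 'a \<Rightarrow> 'a \<Rightarrow> real"
  where "vdist H x y = vnorm H (vadd H x (vscale H (-1) y))"

definition lin_subspace :: "'a inner_space \<Rightarrow> 'a set \<Rightarrow> bool"
  where "lin_subspace H V \<longleftrightarrow>
    V \<subseteq> vecs H \<and> vzero H \<in> V \<and>
    (\<forall>x\<in>V. \<forall>y\<in>V. vadd H x y \<in> V) \<and> (\<forall>c. \<forall>x\<in>V. vscale H c x \<in> V)"

definition lin_span :: "'a inner_space \<Rightarrow> 'a set \<Rightarrow> 'a set"
  where "lin_span H X = lin_subspace H hull X"

definition norm_closure :: "'a inner_space \<Rightarrow> 'a set \<Rightarrow> 'a set"
  where "norm_closure H V = {x \<in> vecs H. \<forall>e>0. \<exists>y\<in>V. vdist H x y < e}"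

text \<open>Operators are extensional functions on the carrier, so that equality of operators is
  equality in HOL.\<close>

definition bounded_ops :: "'a inner_space \<Rightarrow> ('a \<Rightarrow> 'a) set"
  where "bounded_ops H = {S \<in> vecs H \<rightarrow>\<^sub>E vecs H.
    (\<forall>x\<in>vecs H. \<forall>y\<in>vecs H. S (vadd H x y) = vadd H (S x) (S y)) \<and>
    (\<forall>c. \<forall>x\<in>vecs H. S (vscale H c x) = vscale H c (S x)) \<and>
    (\<exists>K. \<forall>x\<in>vecs H. vnorm H (S x) \<le> K * vnorm H x)}"

definition op_norm :: "'a inner_space \<Rightarrow> ('a \<Rightarrow> 'a) \<Rightarrow> real"
  where "op_norm H S = (SUP x\<in>{x \<in> vecs H. vnorm H x \<le> 1}. vnorm H (S x))"

definition adjoint_op :: "'a inner_space \<Rightarrow> ('a \<Rightarrow> 'a) \<Rightarrow> ('a \<Rightarrow> 'a)"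
  where "adjoint_op H S = (THE T. T \<in> bounded_ops H \<and>
    (\<forall>x\<in>vecs H. \<forall>y\<in>vecs H. vinner H (S x) y = vinner H x (T y)))"

definition commutant :: "'a inner_space \<Rightarrow> ('a \<Rightarrow> 'a) set \<Rightarrow> ('a \<Rightarrow> 'a) set"
  where "commutant H M =
    {T \<in> bounded_ops H. \<forall>S\<in>M. compose (vecs H) S T = compose (vecs H) T S}"

definition von_neumann_algebra :: "'a inner_space \<Rightarrow> ('a \<Rightarrow> 'a) set \<Rightarrow> bool"
  where "von_neumann_algebra H M \<longleftrightarrow>
    M \<subseteq> bounded_ops H \<and> (\<forall>S\<in>M. adjoint_op H S \<in> M) \<and> commutant H (commutant H M) = M"

section \<open>Normed star algebras\<close>

record 'b star_algebra = "(complex, 'b) module" +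
  star :: "'b \<Rightarrow> 'b"
  anorm :: "'b \<Rightarrow> real"

definition operator_algebra :: "'a inner_space \<Rightarrow> ('a \<Rightarrow> 'a) star_algebra"
  where "operator_algebra H =
    \<lparr>carrier = bounded_ops H,
     mult = compose (vecs H),
     one = (\<lambda>x\<in>vecs H. x),
     zero = (\<lambda>x\<in>vecs H. vzero H),
     add = (\<lambda>S T. \<lambda>x\<in>vecs H. vadd H (S x) (T x)),
     smult = (\<lambda>c S. \<lambda>x\<in>vecs H. vscale H c (S x)),
     star = adjoint_op H,
     anorm = op_norm H\<rparr>"

definition direct_sum :: "('i \<Rightarrow> 'b star_algebra) \<Rightarrow> ('i \<Rightarrow> 'b) star_algebra"
  where "direct_sum \<A> =
    \<lparr>carrier = {F. (\<forall>i. F i \<in> carrier (\<A> i)) \<and> bdd_above (range (\<lambda>i. anorm (\<A> i) (F i)))},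
     mult = (\<lambda>F G i. F i \<otimes>\<^bsub>\<A> i\<^esub> G i),
     one = (\<lambda>i. \<one>\<^bsub>\<A> i\<^esub>),
     zero = (\<lambda>i. \<zero>\<^bsub>\<A> i\<^esub>),
     add = (\<lambda>F G i. F i \<oplus>\<^bsub>\<A> i\<^esub> G i),
     smult = (\<lambda>c F i. c \<odot>\<^bsub>\<A> i\<^esub> F i),
     star = (\<lambda>F i. star (\<A> i) (F i)),
     anorm = (\<lambda>F. SUP i. anorm (\<A> i) (F i))\<rparr>"

text \<open>Isomorphisms of W*-algebras are the star-isomorphisms of the underlying star algebras;
  weak* continuity is automatic for these.\<close>

definition isometric_star_iso :: "'b star_algebra \<Rightarrow> 'c star_algebra \<Rightarrow> ('b \<Rightarrow> 'c) set"
  where "isometric_star_iso A B = {\<Phi> \<in> ring_iso A B.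
    (\<forall>c. \<forall>S\<in>carrier A. \<Phi> (c \<odot>\<^bsub>A\<^esub> S) = c \<odot>\<^bsub>B\<^esub> \<Phi> S) \<and>
    (\<forall>S\<in>carrier A. \<Phi> (star A S) = star B (\<Phi> S)) \<and>
    (\<forall>S\<in>carrier A. anorm B (\<Phi> S) = anorm A S)}"

section \<open>Weighted L2 spaces on the unit disk\<close>

definition disk_measure :: "real \<Rightarrow> complex measure"
  where "disk_measure \<alpha> = density (restrict_space lborel (ball 0 1))
    (\<lambda>z. ennreal ((\<alpha> + 1) / pi * (1 - (cmod z)\<^sup>2) powr \<alpha>))"

definition sq_integrable :: "real \<Rightarrow> (complex \<Rightarrow> complex) set"
  where "sq_integrable \<alpha> = {f \<in> borel_measurable (disk_measure \<alpha>).
    integrable (disk_measure \<alpha>) (\<lambda>z. (cmod (f z))\<^sup>2)}"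

text \<open>Functions on the disk are represented by functions on the whole plane. The values outside
  the disk are irrelevant, because \<^term>\<open>space (disk_measure \<alpha>)\<close> is the disk.\<close>

definition ae_rel :: "real \<Rightarrow> ((complex \<Rightarrow> complex) \<times> (complex \<Rightarrow> complex)) set"
  where "ae_rel \<alpha> = {(f, g). f \<in> sq_integrable \<alpha> \<and> g \<in> sq_integrable \<alpha> \<and>
    (AE z in disk_measure \<alpha>. f z = g z)}"

definition L2_class :: "real \<Rightarrow> (complex \<Rightarrow> complex) \<Rightarrow> (complex \<Rightarrow> complex) set"
  where "L2_class \<alpha> f = ae_rel \<alpha> `` {f}"

definition L2_disk :: "real \<Rightarrow> (complex \<Rightarrow> complex) set inner_space"
  where "L2_disk \<alpha> =
    \<lparr>vecs = sq_integrable \<alpha> // ae_rel \<alpha>,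
     vadd = (\<lambda>A B. \<Union>f\<in>A. \<Union>g\<in>B. L2_class \<alpha> (\<lambda>z. f z + g z)),
     vzero = L2_class \<alpha> (\<lambda>z. 0),
     vscale = (\<lambda>c A. \<Union>f\<in>A. L2_class \<alpha> (\<lambda>z. c * f z)),
     vinner = (\<lambda>A B. the_elem (\<Union>f\<in>A. \<Union>g\<in>B. {LINT z|disk_measure \<alpha>. f z * cnj (g z)}))\<rparr>"

section \<open>Radial operators\<close>

definition rotation ::
    "real \<Rightarrow> complex \<Rightarrow> (complex \<Rightarrow> complex) set \<Rightarrow> (complex \<Rightarrow> complex) set"
  where "rotation \<alpha> \<tau> =
    (\<lambda>A\<in>vecs (L2_disk \<alpha>). \<Union>f\<in>A. L2_class \<alpha> (\<lambda>z. f (inverse \<tau> * z)))"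

definition radial_ops :: "real \<Rightarrow> ((complex \<Rightarrow> complex) set \<Rightarrow> (complex \<Rightarrow> complex) set) set"
  where "radial_ops \<alpha> = {S \<in> bounded_ops (L2_disk \<alpha>). \<forall>\<tau>\<in>sphere 0 1.
    compose (vecs (L2_disk \<alpha>)) (rotation \<alpha> \<tau>) S =
    compose (vecs (L2_disk \<alpha>)) S (rotation \<alpha> \<tau>)}"

definition radial_algebra ::
    "real \<Rightarrow> ((complex \<Rightarrow> complex) set \<Rightarrow> (complex \<Rightarrow> complex) set) star_algebra"
  where "radial_algebra \<alpha> = (operator_algebra (L2_disk \<alpha>))\<lparr>carrier := radial_ops \<alpha>\<rparr>"

definition W_set :: "real \<Rightarrow> int \<Rightarrow> (complex \<Rightarrow> complex) set set"
  where "W_set \<alpha> \<xi> = norm_closure (L2_disk \<alpha>) (lin_span (L2_disk \<alpha>)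
    {L2_class \<alpha> (\<lambda>z. z ^ p * cnj z ^ q) | p q :: nat. int p - int q = \<xi>})"

definition W_space :: "real \<Rightarrow> int \<Rightarrow> (complex \<Rightarrow> complex) set inner_space"
  where "W_space \<alpha> \<xi> = (L2_disk \<alpha>)\<lparr>vecs := W_set \<alpha> \<xi>\<rparr>"

end

theory Submission
  imports Defs
begin

text \<open>The space \<open>W\<^sub>\<xi>\<close> is the joint eigenspace \<open>{f. \<rho>(\<tau>) f = \<tau>\<^sup>-\<^sup>\<xi> f}\<close> of the rotations: it is contained in
  the eigenspace, eigenspaces for different \<open>\<xi>\<close> are orthogonal because rotations are unitary, and the
  \<open>W\<^sub>\<xi>\<close> are total, by Stone-Weierstrass. So an operator commutes with all rotations if and only if
  it leaves every \<open>W\<^sub>\<xi>\<close> invariant. Restriction to the \<open>W\<^sub>\<xi>\<close> is then the isomorphism onto the direct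
  sum; a bounded family of blocks is glued to an operator by the Riesz representation theorem. Being
  the commutant of a set of operators and closed under adjoints, the radial operators form a von
  Neumann algebra.\<close>

section \<open>Hilbert spaces with an explicit carrier\<close>

text \<open>The locale records only closure, the laws of the inner product and
  \<open>vdist_eq_0D\<close>; every identity between vectors, even the rearrangement of a sum, is
  recovered by testing inner products. Nor are series of vectors formed: a decomposition enters only
  through totality (zero is the only vector orthogonal to all blocks), so that existence claims
  become bounded forms and equalities become tests against the blocks. This is why inclusion of each
  W_xi in its eigenspace suffices for equality: an eigenvector is orthogonal to all other blocks, so
  it passes the same tests as its projection to W_xi. Isometry works alike: the glued operator has
  norm at most the supremum of the block norms, and by uniqueness on the blocks it is the operator
  one started from. The analytic work is on the concrete side: completeness of L2, rotation
  invariance of the measure, and the vanishing of a function all of whose moments vanish. The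
  hypothesis alpha > -1 makes the measure finite and hence the monomials square integrable.\<close>

locale pre_hilbert =
  fixes H :: "'a inner_space"
  assumes add_closed [simp]: "x \<in> vecs H \<Longrightarrow> y \<in> vecs H \<Longrightarrow> vadd H x y \<in> vecs H"
    and zero_closed [simp]: "vzero H \<in> vecs H"
    and scale_closed [simp]: "x \<in> vecs H \<Longrightarrow> vscale H c x \<in> vecs H"
    and inner_add_left [simp]: "x \<in> vecs H \<Longrightarrow> y \<in> vecs H \<Longrightarrow> z \<in> vecs H \<Longrightarrow>
      vinner H (vadd H x y) z = vinner H x z + vinner H y z"
    and inner_scale_left [simp]: "x \<in> vecs H \<Longrightarrow> y \<in> vecs H \<Longrightarrow>
      vinner H (vscale H c x) y = c * vinner H x y"
    and inner_zero_left [simp]: "x \<in> vecs H \<Longrightarrow> vinner H (vzero H) x = 0"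
    and inner_commute: "x \<in> vecs H \<Longrightarrow> y \<in> vecs H \<Longrightarrow> vinner H y x = cnj (vinner H x y)"
    and inner_self_nonneg: "x \<in> vecs H \<Longrightarrow> 0 \<le> Re (vinner H x x)"
    and vdist_eq_0D: "x \<in> vecs H \<Longrightarrow> y \<in> vecs H \<Longrightarrow> vdist H x y = 0 \<Longrightarrow> x = y"
begin

section \<open>Inner product, norm and distance\<close>

lemma inner_add_right [simp]:
  assumes "x \<in> vecs H" "y \<in> vecs H" "z \<in> vecs H"
  shows "vinner H z (vadd H x y) = vinner H z x + vinner H z y"
  using assms by (metis add_closed complex_cnj_add inner_add_left inner_commute)

lemma inner_scale_right [simp]:
  assumes "x \<in> vecs H" "y \<in> vecs H"
  shows "vinner H x (vscale H c y) = cnj c * vinner H x y"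
  using assms by (metis complex_cnj_mult inner_scale_left inner_commute scale_closed)

lemma inner_zero_right [simp]: "x \<in> vecs H \<Longrightarrow> vinner H x (vzero H) = 0"
  by (metis complex_cnj_zero inner_commute inner_zero_left zero_closed)

lemma vnorm_nonneg [simp]: "x \<in> vecs H \<Longrightarrow> 0 \<le> vnorm H x"
  by (simp add: vnorm_def inner_self_nonneg)

lemma vnorm_sq: "x \<in> vecs H \<Longrightarrow> (vnorm H x)\<^sup>2 = Re (vinner H x x)"
  by (simp add: vnorm_def inner_self_nonneg)

lemma inner_self: "x \<in> vecs H \<Longrightarrow> vinner H x x = of_real ((vnorm H x)\<^sup>2)"
  by (metis complex_eq_iff complex_cnj Re_complex_of_real Im_complex_of_real cnj.sel(2)
      inner_commute vnorm_sq neg_equal_zero)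

lemma vdist_sq:
  assumes "x \<in> vecs H" "y \<in> vecs H"
  shows "(vdist H x y)\<^sup>2 = (vnorm H x)\<^sup>2 + (vnorm H y)\<^sup>2 - 2 * Re (vinner H x y)"
proof -
  have "Re (vinner H y x) = Re (vinner H x y)"
    using inner_commute[OF assms] by simp
  then show ?thesis
    using assms by (simp add: vdist_def vnorm_sq)
qed

lemma vnorm_eq_0D: "x \<in> vecs H \<Longrightarrow> vnorm H x = 0 \<Longrightarrow> x = vzero H"
  by (rule vdist_eq_0D) (simp_all add: vdist_def vnorm_def)

lemma vnorm_zero [simp]: "vnorm H (vzero H) = 0"
  by (simp add: vnorm_def)

text \<open>Choosing z = x - y makes the norm of x - y vanish. This stands in for vector space
  axioms: vector identities are obtained by expanding both sides under the inner product.\<close>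

lemma vec_eqI:
  assumes "x \<in> vecs H" "y \<in> vecs H" "\<And>z. z \<in> vecs H \<Longrightarrow> vinner H x z = vinner H y z"
  shows "x = y"
proof (rule vdist_eq_0D)
  have "Re (vinner H x (vadd H x (vscale H (-1) y))) = Re (vinner H y (vadd H x (vscale H (-1) y)))"
    using assms by (intro arg_cong[of _ _ Re] assms(3)) simp
  then show "vdist H x y = 0"
    using assms(1,2) by (simp add: vdist_def vnorm_def)
qed (use assms in auto)

lemma vnorm_scale:
  assumes "x \<in> vecs H" shows "vnorm H (vscale H c x) = cmod c * vnorm H x"
proof (rule power2_eq_imp_eq)
  have "c * (cnj c * vinner H x x) = of_real ((cmod c * vnorm H x)\<^sup>2)"
    using assms by (simp add: inner_self power_mult_distrib flip: mult.assoc complex_norm_square)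
  then show "(vnorm H (vscale H c x))\<^sup>2 = (cmod c * vnorm H x)\<^sup>2"
    using assms by (simp add: vnorm_sq mult_ac)
qed (use assms in auto)

lemma Cauchy_Schwarz:
  assumes x: "x \<in> vecs H" and y: "y \<in> vecs H"
  shows "cmod (vinner H x y) \<le> vnorm H x * vnorm H y"
proof (cases "vnorm H y = 0")
  case True
  then show ?thesis using vnorm_eq_0D[OF y] x by simp
next
  case False
  let ?a = "vnorm H x" and ?b = "vnorm H y" and ?c = "vinner H x y"
  \<comment> \<open>This is |y|^2 times the component of x orthogonal to y, scaled to avoid
    division; its squared norm is |y|^2 times the gap in the squared inequality.\<close>
  let ?z = "vadd H (vscale H (of_real (?b\<^sup>2)) x) (vscale H (- ?c) y)"
  have "?c * cnj ?c = of_real (cmod ?c) * of_real (cmod ?c)"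
    by (metis complex_norm_square of_real_mult power2_eq_square)
  then have "vinner H ?z ?z = of_real (?b\<^sup>2 * (?a\<^sup>2 * ?b\<^sup>2 - (cmod ?c)\<^sup>2))"
    using x y by (simp add: inner_commute[OF x y] inner_self[OF x] inner_self[OF y] algebra_simps complex_norm_square
        power2_eq_square del: of_real_power)
  then have "0 \<le> ?b\<^sup>2 * (?a\<^sup>2 * ?b\<^sup>2 - (cmod ?c)\<^sup>2)"
    using inner_self_nonneg[of ?z] x y by (metis Re_complex_of_real add_closed scale_closed)
  then have "(cmod ?c)\<^sup>2 \<le> (?a * ?b)\<^sup>2"
    using False by (simp add: zero_le_mult_iff power_mult_distrib)
  then show ?thesis
    using x y by (simp add: power2_le_iff_abs_le)
qed

lemma vnorm_triangle:
  assumes x: "x \<in> vecs H" and y: "y \<in> vecs H"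
  shows "vnorm H (vadd H x y) \<le> vnorm H x + vnorm H y"
proof (rule power2_le_imp_le)
  have "Re (vinner H x y) \<le> vnorm H x * vnorm H y"
    using Cauchy_Schwarz[OF x y] complex_Re_le_cmod order_trans by blast
  moreover have "Re (vinner H y x) = Re (vinner H x y)"
    using inner_commute[OF x y] by simp
  ultimately show "(vnorm H (vadd H x y))\<^sup>2 \<le> (vnorm H x + vnorm H y)\<^sup>2"
    using x y by (simp add: vnorm_sq power2_sum)
qed (use x y in auto)

lemma vdist_commute:
  assumes "x \<in> vecs H" "y \<in> vecs H" shows "vdist H x y = vdist H y x"
proof (rule power2_eq_imp_eq)
  show "(vdist H x y)\<^sup>2 = (vdist H y x)\<^sup>2"
    using assms inner_commute[of x y] by (simp add: vdist_sq)
qed (use assms in \<open>auto simp: vdist_def\<close>)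

lemma vdist_triangle:
  assumes "x \<in> vecs H" "y \<in> vecs H" "z \<in> vecs H"
  shows "vdist H x z \<le> vdist H x y + vdist H y z"
proof -
  have "vadd H x (vscale H (-1) z) =
      vadd H (vadd H x (vscale H (-1) y)) (vadd H y (vscale H (-1) z))"
    using assms by (intro vec_eqI) auto
  then show ?thesis
    using assms vnorm_triangle[of "vadd H x (vscale H (-1) y)" "vadd H y (vscale H (-1) z)"]
    by (simp add: vdist_def)
qed

lemma vdist_nonneg [simp]: "x \<in> vecs H \<Longrightarrow> y \<in> vecs H \<Longrightarrow> 0 \<le> vdist H x y"
  by (simp add: vdist_def)

lemma inner_diff_bound:
  assumes "x \<in> vecs H" "y \<in> vecs H" "z \<in> vecs H"
  shows "cmod (vinner H x z - vinner H y z) \<le> vdist H x y * vnorm H z"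
  using Cauchy_Schwarz[of "vadd H x (vscale H (-1) y)" z] assms by (simp add: vdist_def)

lemma tendsto_inner_left:
  assumes "\<And>n. X n \<in> vecs H" "x \<in> vecs H" "z \<in> vecs H" "(\<lambda>n. vdist H (X n) x) \<longlonglongrightarrow> 0"
  shows "(\<lambda>n. vinner H (X n) z) \<longlonglongrightarrow> vinner H x z"
proof -
  have "(\<lambda>n. vinner H (X n) z - vinner H x z) \<longlonglongrightarrow> 0"
  proof (rule Lim_null_comparison)
    show "\<forall>\<^sub>F n in sequentially. cmod (vinner H (X n) z - vinner H x z) \<le> vdist H (X n) x * vnorm H z"
      using assms inner_diff_bound by simp
    show "(\<lambda>n. vdist H (X n) x * vnorm H z) \<longlonglongrightarrow> 0"
      using tendsto_mult_right[OF assms(4)] by simp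
  qed
  then show ?thesis
    by (simp add: LIM_zero_cancel)
qed

section \<open>Spans and norm closures\<close>

lemma lin_subspace_lin_span: "X \<subseteq> vecs H \<Longrightarrow> lin_subspace H (lin_span H X)"
proof -
  assume "X \<subseteq> vecs H"
  then have "lin_span H X \<subseteq> vecs H"
    unfolding lin_span_def by (intro hull_minimal) (simp_all add: lin_subspace_def)
  then show ?thesis
    unfolding lin_span_def hull_def lin_subspace_def by blast
qed

lemma lin_span_superset: "X \<subseteq> lin_span H X"
  unfolding lin_span_def by (rule hull_subset)

lemma lin_span_minimal: "X \<subseteq> U \<Longrightarrow> lin_subspace H U \<Longrightarrow> lin_span H X \<subseteq> U"
  unfolding lin_span_def by (rule hull_minimal)

lemma norm_closure_superset: "U \<subseteq> vecs H \<Longrightarrow> U \<subseteq> norm_closure H U"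
proof
  fix x assume "U \<subseteq> vecs H" "x \<in> U"
  moreover from this have "vdist H x x = 0" by (auto simp: vdist_def vnorm_def)
  ultimately show "x \<in> norm_closure H U"
    by (auto simp: norm_closure_def intro!: bexI[of _ x])
qed

lemma norm_closureE:
  assumes "x \<in> norm_closure H U" "e > 0"
  obtains y where "y \<in> U" "vdist H x y < e"
  using assms by (auto simp: norm_closure_def)

lemma norm_closure_mono: "U \<subseteq> U' \<Longrightarrow> norm_closure H U \<subseteq> norm_closure H U'"
  unfolding norm_closure_def by blast

lemma norm_closure_idem:
  assumes "U \<subseteq> vecs H" shows "norm_closure H (norm_closure H U) \<subseteq> norm_closure H U"
proof
  fix x assume x: "x \<in> norm_closure H (norm_closure H U)"
  then have xV: "x \<in> vecs H" by (simp add: norm_closure_def)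
  moreover have "\<exists>y\<in>U. vdist H x y < e" if e: "e > 0" for e
  proof -
    obtain y where y: "y \<in> norm_closure H U" "vdist H x y < e/2"
      using norm_closureE[OF x half_gt_zero[OF e]] by blast
    then obtain z where z: "z \<in> U" "vdist H y z < e/2"
      using norm_closureE[OF y(1) half_gt_zero[OF e]] by blast
    then have "vdist H x z < e"
      using vdist_triangle[of x y z] y xV assms by (auto simp: norm_closure_def)
    with z show ?thesis by blast
  qed
  ultimately show "x \<in> norm_closure H U" by (simp add: norm_closure_def)
qed

lemma lin_subspace_norm_closure:
  assumes U: "lin_subspace H U" shows "lin_subspace H (norm_closure H U)"
  unfolding lin_subspace_def
proof (intro conjI ballI allI)
  have UV: "U \<subseteq> vecs H" using U by (simp add: lin_subspace_def)
  show "norm_closure H U \<subseteq> vecs H" by (auto simp: norm_closure_def)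
  show "vzero H \<in> norm_closure H U"
    using norm_closure_superset[OF UV] U by (auto simp: lin_subspace_def)
  fix x assume x: "x \<in> norm_closure H U"
  then have xV: "x \<in> vecs H" by (simp add: norm_closure_def)
  show "vadd H x y \<in> norm_closure H U" if y: "y \<in> norm_closure H U" for y
  proof -
    have yV: "y \<in> vecs H" using y by (simp add: norm_closure_def)
    have "\<exists>z\<in>U. vdist H (vadd H x y) z < e" if e: "e > 0" for e
    proof -
      obtain a b where ab: "a \<in> U" "b \<in> U" "vdist H x a < e/2" "vdist H y b < e/2"
        using norm_closureE[OF x half_gt_zero[OF e]] norm_closureE[OF y half_gt_zero[OF e]]
        by metis
      then have "a \<in> vecs H" "b \<in> vecs H" using UV by auto
      then have "vadd H (vadd H x y) (vscale H (-1) (vadd H a b)) =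
        vadd H (vadd H x (vscale H (-1) a)) (vadd H y (vscale H (-1) b))"
        using xV yV by (intro vec_eqI) auto
      then have "vdist H (vadd H x y) (vadd H a b) < e"
        using vnorm_triangle[of "vadd H x (vscale H (-1) a)" "vadd H y (vscale H (-1) b)"]
          xV yV \<open>a \<in> vecs H\<close> \<open>b \<in> vecs H\<close> ab by (simp add: vdist_def)
      moreover have "vadd H a b \<in> U" using ab U by (simp add: lin_subspace_def)
      ultimately show ?thesis by blast
    qed
    with xV yV show ?thesis by (simp add: norm_closure_def)
  qed
  show "vscale H c x \<in> norm_closure H U" for c
  proof -
    have "\<exists>z\<in>U. vdist H (vscale H c x) z < e" if "e > 0" for e
    proof -
      \<comment> \<open>The added 1 keeps the denominator positive when c = 0.\<close>
      have "e / (cmod c + 1) > 0"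
        using that by (simp add: add_nonneg_pos)
      then obtain a where a: "a \<in> U" "vdist H x a < e / (cmod c + 1)"
        using norm_closureE[OF x] by blast
      then have aV: "a \<in> vecs H" using UV by auto
      have "vadd H (vscale H c x) (vscale H (-1) (vscale H c a)) =
        vscale H c (vadd H x (vscale H (-1) a))"
        using xV aV by (intro vec_eqI) (auto simp: algebra_simps)
      then have "vdist H (vscale H c x) (vscale H c a) = cmod c * vdist H x a"
        using xV aV by (simp add: vdist_def vnorm_scale)
      also have "\<dots> \<le> (cmod c + 1) * vdist H x a"
        using xV aV by (intro mult_right_mono) auto
      also have "\<dots> < e"
        using a by (simp add: pos_less_divide_eq add_nonneg_pos mult.commute)
      finally have "vdist H (vscale H c x) (vscale H c a) < e" .
      moreover have "vscale H c a \<in> U" using a U by (simp add: lin_subspace_def)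
      ultimately show ?thesis by blast
    qed
    with xV show ?thesis by (simp add: norm_closure_def)
  qed
qed

text \<open>Only the carrier changes, so norms and distances stay those of \<open>H\<close>. This
  lets the general theory be applied inside each block.\<close>

lemma pre_hilbert_subspace:
  assumes "lin_subspace H U" shows "pre_hilbert (H\<lparr>vecs := U\<rparr>)"
proof -
  have UV: "x \<in> vecs H" if "x \<in> U" for x using that assms by (auto simp: lin_subspace_def)
  show ?thesis
  proof
    fix x y assume "x \<in> vecs (H\<lparr>vecs := U\<rparr>)" "y \<in> vecs (H\<lparr>vecs := U\<rparr>)"
    then show "vinner (H\<lparr>vecs := U\<rparr>) y x = cnj (vinner (H\<lparr>vecs := U\<rparr>) x y)"
      and "vdist (H\<lparr>vecs := U\<rparr>) x y = 0 \<Longrightarrow> x = y"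
      using UV inner_commute[of x y] vdist_eq_0D[of x y] by (auto simp: vdist_def vnorm_def)
  qed (use assms UV inner_self_nonneg in \<open>auto simp: lin_subspace_def\<close>)
qed

lemma vnorm_subspace [simp]: "vnorm (H\<lparr>vecs := U\<rparr>) = vnorm H"
  by (simp add: vnorm_def fun_eq_iff)

lemma vdist_subspace [simp]: "vdist (H\<lparr>vecs := U\<rparr>) = vdist H"
  by (simp add: vdist_def fun_eq_iff)

section \<open>Bounded operators, operator norm and uniqueness of adjoints\<close>

lemma bounded_ops_add: "S \<in> bounded_ops H \<Longrightarrow> x \<in> vecs H \<Longrightarrow> y \<in> vecs H \<Longrightarrow>
    S (vadd H x y) = vadd H (S x) (S y)"
  and bounded_ops_scale: "S \<in> bounded_ops H \<Longrightarrow> x \<in> vecs H \<Longrightarrow> S (vscale H c x) = vscale H c (S x)"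
  and bounded_ops_closed [simp]: "S \<in> bounded_ops H \<Longrightarrow> x \<in> vecs H \<Longrightarrow> S x \<in> vecs H"
  and bounded_ops_extensional: "S \<in> bounded_ops H \<Longrightarrow> S \<in> extensional (vecs H)"
  by (auto simp: bounded_ops_def PiE_def)

lemma bounded_opsI:
  assumes "S \<in> extensional (vecs H)" "\<And>x. x \<in> vecs H \<Longrightarrow> S x \<in> vecs H"
    "\<And>x y. x \<in> vecs H \<Longrightarrow> y \<in> vecs H \<Longrightarrow> S (vadd H x y) = vadd H (S x) (S y)"
    "\<And>c x. x \<in> vecs H \<Longrightarrow> S (vscale H c x) = vscale H c (S x)"
    "\<And>x. x \<in> vecs H \<Longrightarrow> vnorm H (S x) \<le> K * vnorm H x"
  shows "S \<in> bounded_ops H"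
  using assms unfolding bounded_ops_def mem_Collect_eq PiE_def by blast

lemma bounded_ops_bound:
  assumes "S \<in> bounded_ops H"
  obtains K where "K \<ge> 0" "\<And>x. x \<in> vecs H \<Longrightarrow> vnorm H (S x) \<le> K * vnorm H x"
proof -
  obtain K where K: "\<And>x. x \<in> vecs H \<Longrightarrow> vnorm H (S x) \<le> K * vnorm H x"
    using assms unfolding bounded_ops_def by blast
  have "vnorm H (S x) \<le> \<bar>K\<bar> * vnorm H x" if "x \<in> vecs H" for x
    using K[OF that] mult_right_mono[OF abs_ge_self vnorm_nonneg[OF that], of K] by linarith
  with that show thesis by (metis abs_ge_zero)
qed

lemma op_norm_bdd:
  assumes "S \<in> bounded_ops H"
  shows "bdd_above ((\<lambda>x. vnorm H (S x)) ` {x \<in> vecs H. vnorm H x \<le> 1})"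
proof -
  obtain K where K: "K \<ge> 0" "\<And>x. x \<in> vecs H \<Longrightarrow> vnorm H (S x) \<le> K * vnorm H x"
    using bounded_ops_bound[OF assms] by metis
  have "vnorm H (S x) \<le> K" if "x \<in> vecs H" "vnorm H x \<le> 1" for x
    using K(2)[OF that(1)] mult_left_mono[OF that(2) K(1)] by simp
  then show ?thesis by (auto intro!: bdd_aboveI)
qed

lemma op_norm_nonneg: "S \<in> bounded_ops H \<Longrightarrow> 0 \<le> op_norm H S"
  unfolding op_norm_def
  by (rule cSUP_upper2[OF op_norm_bdd, of S "vzero H"]) auto

lemma op_norm_bound:
  assumes S: "S \<in> bounded_ops H" and x: "x \<in> vecs H"
  shows "vnorm H (S x) \<le> op_norm H S * vnorm H x"
proof (cases "vnorm H x = 0")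
  case True
  \<comment> \<open>A vector of norm 0 cannot be normalised; here any bound K forces
    \<open>S x\<close> to have norm 0.\<close>
  obtain K where "\<And>x. x \<in> vecs H \<Longrightarrow> vnorm H (S x) \<le> K * vnorm H x"
    using bounded_ops_bound[OF S] by metis
  then show ?thesis using True x by force
next
  case False
  then have pos: "vnorm H x > 0" using x by (simp add: order_le_neq_trans)
  let ?y = "vscale H (of_real (1 / vnorm H x)) x"
  have "vnorm H ?y = 1" using pos x by (simp add: vnorm_scale norm_divide)
  then have "vnorm H (S ?y) \<le> op_norm H S"
    unfolding op_norm_def using x by (intro cSUP_upper op_norm_bdd S) auto
  also have "vnorm H (S ?y) = vnorm H (S x) / vnorm H x"
    using S x pos by (simp add: bounded_ops_scale vnorm_scale norm_divide)
  finally show ?thesis using pos by (simp add: pos_divide_le_eq)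
qed

lemma op_norm_le:
  assumes "K \<ge> 0" "\<And>x. x \<in> vecs H \<Longrightarrow> vnorm H (S x) \<le> K * vnorm H x"
  shows "op_norm H S \<le> K"
  unfolding op_norm_def
proof (rule cSUP_least)
  show "{x \<in> vecs H. vnorm H x \<le> 1} \<noteq> {}"
    by (auto intro!: exI[of _ "vzero H"])
  fix x assume x: "x \<in> {x \<in> vecs H. vnorm H x \<le> 1}"
  then show "vnorm H (S x) \<le> K"
    using assms(2)[of x] mult_left_mono[of "vnorm H x" 1 K] assms(1) by auto
qed

lemma bounded_ops_eqI:
  assumes "S \<in> bounded_ops H" "T \<in> bounded_ops H" "\<And>x. x \<in> vecs H \<Longrightarrow> S x = T x"
  shows "S = T"
  using assms by (metis bounded_ops_extensional extensionalityI)

lemma compose_bounded_ops: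
  assumes S: "S \<in> bounded_ops H" and T: "T \<in> bounded_ops H"
  shows "compose (vecs H) S T \<in> bounded_ops H"
proof -
  obtain K where K: "K \<ge> 0" "\<And>x. x \<in> vecs H \<Longrightarrow> vnorm H (S x) \<le> K * vnorm H x"
    using bounded_ops_bound[OF S] by metis
  obtain L where L: "L \<ge> 0" "\<And>x. x \<in> vecs H \<Longrightarrow> vnorm H (T x) \<le> L * vnorm H x"
    using bounded_ops_bound[OF T] by metis
  show ?thesis
  proof (rule bounded_opsI)
    show "vnorm H (compose (vecs H) S T x) \<le> K * L * vnorm H x" if "x \<in> vecs H" for x
      using K(2)[of "T x"] mult_left_mono[OF L(2)[OF that] K(1)] that T
      by (simp add: compose_def mult.assoc)
  qed (use S T in \<open>auto simp: compose_def bounded_ops_add bounded_ops_scale\<close>)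
qed

text \<open>\<open>adjoint_op\<close> is a definite description, so identifying it takes uniqueness:
  two candidates have equal inner products with every vector.\<close>

lemma adjoint_op_eqI:
  assumes "S \<in> bounded_ops H" "T \<in> bounded_ops H"
    "\<And>x y. x \<in> vecs H \<Longrightarrow> y \<in> vecs H \<Longrightarrow> vinner H (S x) y = vinner H x (T y)"
  shows "adjoint_op H S = T"
  unfolding adjoint_op_def
proof (rule the_equality)
  fix R assume R: "R \<in> bounded_ops H \<and> (\<forall>x\<in>vecs H. \<forall>y\<in>vecs H. vinner H (S x) y = vinner H x (R y))"
  show "R = T"
  proof (rule bounded_ops_eqI)
    fix y assume y: "y \<in> vecs H"
    show "R y = T y"
    proof (rule vec_eqI)
      fix z assume "z \<in> vecs H"
      then show "vinner H (R y) z = vinner H (T y) z"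
        using R assms y by (metis inner_commute bounded_ops_closed)
    qed (use R assms y in auto)
  qed (use R assms in auto)
qed (use assms in auto)

end

section \<open>Completeness: Riesz representation, adjoints and projections\<close>

locale hilbert = pre_hilbert +
  assumes complete: "(\<And>n. X n \<in> vecs H) \<Longrightarrow>
    (\<And>e. e > 0 \<Longrightarrow> \<exists>N. \<forall>m\<ge>N. \<forall>n\<ge>N. vdist H (X m) (X n) < e) \<Longrightarrow>
    \<exists>x\<in>vecs H. (\<lambda>n. vdist H (X n) x) \<longlonglongrightarrow> 0"
begin

text \<open>The limit exists in \<open>H\<close> and lies in the norm closure of \<open>U\<close>.
  Through this, Riesz representation is available inside each block.\<close>

lemma hilbert_closed_subspace:
  assumes U: "lin_subspace H U" and cl: "norm_closure H U \<subseteq> U"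
  shows "hilbert (H\<lparr>vecs := U\<rparr>)"
proof -
  interpret U: pre_hilbert "H\<lparr>vecs := U\<rparr>" by (rule pre_hilbert_subspace[OF U])
  have UV: "U \<subseteq> vecs H" using U by (auto simp: lin_subspace_def)
  show ?thesis
  proof
    fix X :: "nat \<Rightarrow> 'a" assume X: "\<And>n. X n \<in> vecs (H\<lparr>vecs := U\<rparr>)"
      and C: "\<And>e. e > 0 \<Longrightarrow> \<exists>N. \<forall>m\<ge>N. \<forall>n\<ge>N. vdist (H\<lparr>vecs := U\<rparr>) (X m) (X n) < e"
    then obtain x where x: "x \<in> vecs H" "(\<lambda>n. vdist H (X n) x) \<longlonglongrightarrow> 0"
      using complete[of X] UV by (auto simp: subset_iff)
    have "\<exists>y\<in>U. vdist H x y < e" if e: "e > 0" for e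
    proof -
      obtain n where "vdist H (X n) x < e"
        using order_tendstoD(2)[OF x(2) e] by (auto simp: eventually_sequentially)
      then show ?thesis using vdist_commute[of "X n" x] x X[of n] UV by (auto simp: subset_iff intro!: bexI[of _ "X n"])
    qed
    then have "x \<in> U" using cl x by (auto simp: norm_closure_def)
    with x show "\<exists>x\<in>vecs (H\<lparr>vecs := U\<rparr>). (\<lambda>n. vdist (H\<lparr>vecs := U\<rparr>) (X n) x) \<longlonglongrightarrow> 0"
      by auto
  qed
qed

text \<open>The representing vector is the minimizer of \<open>\<parallel>x\<parallel>\<^sup>2 - 2 Re (\<phi> x)\<close>.\<close>

theorem Riesz_representation:
  fixes \<phi> :: "'a \<Rightarrow> complex"
  assumes add: "\<And>x y. x \<in> vecs H \<Longrightarrow> y \<in> vecs H \<Longrightarrow> \<phi> (vadd H x y) = \<phi> x + \<phi> y"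
    and scale: "\<And>c x. x \<in> vecs H \<Longrightarrow> \<phi> (vscale H c x) = c * \<phi> x"
    and bound: "\<And>x. x \<in> vecs H \<Longrightarrow> cmod (\<phi> x) \<le> K * vnorm H x"
  obtains z where "z \<in> vecs H" "\<And>x. x \<in> vecs H \<Longrightarrow> \<phi> x = vinner H x z"
proof -
  define J where "J x = (vnorm H x)\<^sup>2 - 2 * Re (\<phi> x)" for x
  define m where "m = (INF x\<in>vecs H. J x)"
  \<comment> \<open>Completing the square: J x >= n^2 - 2 K n >= -K^2, where n is the norm of
    x.\<close>
  have "- K\<^sup>2 \<le> J x" if "x \<in> vecs H" for x
  proof -
    have "Re (\<phi> x) \<le> K * vnorm H x"
      using bound[OF that] complex_Re_le_cmod order_trans by blast
    then show ?thesis
      using zero_le_power2[of "vnorm H x - K"] by (simp add: J_def power2_diff algebra_simps)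
  qed
  then have bdd: "bdd_below (J ` vecs H)" by (auto intro!: bdd_belowI)
  then have m_le: "m \<le> J x" if "x \<in> vecs H" for x
    unfolding m_def using that by (intro cINF_lower) auto
  have "\<exists>x\<in>vecs H. J x < m + 1 / real (Suc n)" for n
    using cINF_less_iff[OF _ bdd, of "m + 1 / real (Suc n)"] zero_closed unfolding m_def by fastforce
  then obtain X where X: "\<And>n. X n \<in> vecs H" "\<And>n. J (X n) < m + 1 / real (Suc n)"
    by metis
  \<comment> \<open>Parallelogram law: with h the midpoint, J x + J y - 2 J h is half the squared
    distance, as the linear parts cancel, and J h >= m. So near-minimizers are close to each
    other.\<close>
  have par: "(vdist H x y)\<^sup>2 \<le> 2 * (J x + J y - 2 * m)" if x: "x \<in> vecs H" and y: "y \<in> vecs H" for x y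
  proof -
    let ?h = "vscale H (1/2) (vadd H x y)"
    have n: "(vnorm H ?h)\<^sup>2 = ((vnorm H x)\<^sup>2 + (vnorm H y)\<^sup>2 + 2 * Re (vinner H x y)) / 4"
      using x y inner_commute[OF x y] by (simp add: vnorm_sq field_simps)
    have r: "Re (\<phi> ?h) = (Re (\<phi> x) + Re (\<phi> y)) / 2"
      using x y by (simp add: add scale)
    have "J ?h = ((vnorm H x)\<^sup>2 + (vnorm H y)\<^sup>2 + 2 * Re (vinner H x y)) / 4 -
        (Re (\<phi> x) + Re (\<phi> y))"
      unfolding J_def n r by (simp add: add_divide_distrib)
    moreover have "m \<le> J ?h" using m_le x y by simp
    ultimately show ?thesis
      by (simp add: vdist_sq[OF x y] J_def[of x] J_def[of y] field_simps)
  qed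
  have "\<exists>N. \<forall>i\<ge>N. \<forall>j\<ge>N. vdist H (X i) (X j) < e" if "e > 0" for e
  proof -
    \<comment> \<open>Each of the two errors 1/(k+1) is below e^2/4, so their sum, doubled by
      \<open>par\<close>, stays below e^2.\<close>
    obtain N where N: "4 / e\<^sup>2 < real N" using reals_Archimedean2 by blast
    have "vdist H (X i) (X j) < e" if "i \<ge> N" "j \<ge> N" for i j
    proof (rule power2_less_imp_less)
      have *: "1 / real (Suc k) < e\<^sup>2 / 4" if "k \<ge> N" for k
      proof -
        have "4 / e\<^sup>2 < real (Suc k)" using N that by linarith
        then show ?thesis using \<open>e > 0\<close> by (simp add: field_simps)
      qed
      have "(vdist H (X i) (X j))\<^sup>2 \<le> 2 * (J (X i) + J (X j) - 2 * m)"
        using par X by blast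
      also have "\<dots> < e\<^sup>2"
        using add_strict_mono[OF less_trans[OF X(2) add_strict_left_mono[OF *[OF that(1)]]]
            less_trans[OF X(2) add_strict_left_mono[OF *[OF that(2)]]]]
        by (simp add: field_simps)
      finally show "(vdist H (X i) (X j))\<^sup>2 < e\<^sup>2" .
    qed (use \<open>e > 0\<close> in auto)
    then show ?thesis by blast
  qed
  then obtain z where z: "z \<in> vecs H" "(\<lambda>n. vdist H (X n) z) \<longlonglongrightarrow> 0"
    using complete[of X] X by blast
  have Re_eq: "Re (\<phi> y) = Re (vinner H y z)" if y: "y \<in> vecs H" for y
  proof -
    \<comment> \<open>First variation at the minimizer: J at X n + t y is at least m, which exceeds
      J (X n) - 1/(n+1); then n tends to infinity.\<close>
    have pos: "0 \<le> t\<^sup>2 * (vnorm H y)\<^sup>2 + 2 * t * (Re (vinner H z y) - Re (\<phi> y))" for t :: real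
    proof (rule LIMSEQ_le)
      show "(\<lambda>n. - (1 / real (Suc n))) \<longlonglongrightarrow> 0"
        using tendsto_minus[OF LIMSEQ_Suc[OF lim_1_over_n]] by simp
      show "(\<lambda>n. t\<^sup>2 * (vnorm H y)\<^sup>2 + 2 * t * (Re (vinner H (X n) y) - Re (\<phi> y))) \<longlonglongrightarrow>
        t\<^sup>2 * (vnorm H y)\<^sup>2 + 2 * t * (Re (vinner H z y) - Re (\<phi> y))"
        by (intro tendsto_intros tendsto_inner_left X z y)
      have "- (1 / real (Suc n)) \<le> t\<^sup>2 * (vnorm H y)\<^sup>2 + 2 * t * (Re (vinner H (X n) y) - Re (\<phi> y))" for n
      proof -
        let ?w = "vadd H (X n) (vscale H (of_real t) y)"
        have "Re (vinner H y (X n)) = Re (vinner H (X n) y)"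
          using inner_commute[OF X(1)[of n] y] by simp
        then have "J ?w = J (X n) + t\<^sup>2 * (vnorm H y)\<^sup>2 + 2 * t * (Re (vinner H (X n) y) - Re (\<phi> y))"
          using X(1)[of n] y
          by (simp add: J_def add scale vnorm_sq algebra_simps power2_eq_square[of t])
        then show ?thesis using m_le[of ?w] X[of n] y by simp
      qed
      then show "\<exists>N. \<forall>n\<ge>N. - (1 / real (Suc n)) \<le>
        t\<^sup>2 * (vnorm H y)\<^sup>2 + 2 * t * (Re (vinner H (X n) y) - Re (\<phi> y))" by blast
    qed
    \<comment> \<open>A quadratic in t that is never negative forces d = 0, since t = -d/s gives it
      the value -d^2 (s+1)/s^2. The 1 in s keeps it positive when y has norm 0.\<close>
    define s d where "s = (vnorm H y)\<^sup>2 + 1" and "d = Re (vinner H z y) - Re (\<phi> y)"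
    have s: "s \<ge> 1" by (simp add: s_def)
    have "d = 0"
    proof (rule ccontr)
      assume "d \<noteq> 0"
      have "(- d / s)\<^sup>2 * (s - 1) + 2 * (- d / s) * d = - (d\<^sup>2 * (s + 1) / s\<^sup>2)"
        using s by (simp add: field_simps power2_eq_square)
      moreover have "d\<^sup>2 * (s + 1) / s\<^sup>2 > 0"
        using s \<open>d \<noteq> 0\<close> by (intro divide_pos_pos mult_pos_pos) auto
      ultimately show False
        using pos[of "- d / s"] by (simp add: s_def d_def)
    qed
    then show ?thesis using inner_commute[OF z(1) y] by (simp add: d_def)
  qed
  have "\<phi> x = vinner H x z" if x: "x \<in> vecs H" for x
  proof (rule complex_eqI)
    \<comment> \<open>By complex linearity the real parts at i x determine the imaginary parts at
      x.\<close>
    show "Im (\<phi> x) = Im (vinner H x z)"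
      using Re_eq[of "vscale H \<i> x"] x z by (simp add: scale)
  qed (use Re_eq x in auto)
  with z that show thesis by blast
qed

text \<open>For fixed x, Riesz represents the functional that sends y to the conjugate of B x y; T x
  is the representing vector, and T is linear because B is linear in x. Serves both for adjoints and
  for gluing blocks.\<close>

lemma sesquilinear_form_operator:
  fixes B :: "'a \<Rightarrow> 'a \<Rightarrow> complex"
  assumes addl: "\<And>x y z. x \<in> vecs H \<Longrightarrow> y \<in> vecs H \<Longrightarrow> z \<in> vecs H \<Longrightarrow> B (vadd H x y) z = B x z + B y z"
    and scalel: "\<And>c x y. x \<in> vecs H \<Longrightarrow> y \<in> vecs H \<Longrightarrow> B (vscale H c x) y = c * B x y"
    and addr: "\<And>x y z. x \<in> vecs H \<Longrightarrow> y \<in> vecs H \<Longrightarrow> z \<in> vecs H \<Longrightarrow> B x (vadd H y z) = B x y + B x z"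
    and scaler: "\<And>c x y. x \<in> vecs H \<Longrightarrow> y \<in> vecs H \<Longrightarrow> B x (vscale H c y) = cnj c * B x y"
    and bound: "\<And>x y. x \<in> vecs H \<Longrightarrow> y \<in> vecs H \<Longrightarrow> cmod (B x y) \<le> K * vnorm H x * vnorm H y"
    and "K \<ge> 0"
  obtains T where "T \<in> bounded_ops H" "\<And>x y. x \<in> vecs H \<Longrightarrow> y \<in> vecs H \<Longrightarrow> vinner H (T x) y = B x y"
    "\<And>x. x \<in> vecs H \<Longrightarrow> vnorm H (T x) \<le> K * vnorm H x"
proof -
  have "\<exists>z\<in>vecs H. \<forall>y\<in>vecs H. vinner H z y = B x y" if x: "x \<in> vecs H" for x
  proof -
    obtain z where "z \<in> vecs H" "\<And>y. y \<in> vecs H \<Longrightarrow> cnj (B x y) = vinner H y z"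
      by (rule Riesz_representation[of "\<lambda>y. cnj (B x y)" "K * vnorm H x"])
        (use x bound in \<open>auto simp: addr scaler\<close>)
    then show ?thesis using x by (metis complex_cnj_cnj inner_commute)
  qed
  then obtain T0 where T0: "\<And>x. x \<in> vecs H \<Longrightarrow> T0 x \<in> vecs H"
    "\<And>x y. x \<in> vecs H \<Longrightarrow> y \<in> vecs H \<Longrightarrow> vinner H (T0 x) y = B x y"
    by metis
  define T where "T = restrict T0 (vecs H)"
  have T: "\<And>x. x \<in> vecs H \<Longrightarrow> T x \<in> vecs H"
    "\<And>x y. x \<in> vecs H \<Longrightarrow> y \<in> vecs H \<Longrightarrow> vinner H (T x) y = B x y"
    by (auto simp: T_def T0)
  \<comment> \<open>|T x|^2 = B x (T x) <= K |x| |T x|, and one factor |T x| cancels unless it is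
    0.\<close>
  have nT: "vnorm H (T x) \<le> K * vnorm H x" if x: "x \<in> vecs H" for x
  proof -
    have "vnorm H (T x) * vnorm H (T x) = cmod (vinner H (T x) (T x))"
      using T x by (simp add: inner_self power2_eq_square norm_mult)
    also have "\<dots> \<le> K * vnorm H x * vnorm H (T x)"
      using T x bound by simp
    finally show ?thesis
      using vnorm_nonneg[OF T(1)[OF x]] x \<open>K \<ge> 0\<close>
      by (cases "vnorm H (T x) = 0") (auto simp: mult_le_cancel_right)
  qed
  have "T \<in> bounded_ops H"
  proof (rule bounded_opsI)
    show "T (vadd H x y) = vadd H (T x) (T y)" if "x \<in> vecs H" "y \<in> vecs H" for x y
      by (rule vec_eqI) (use that T addl in auto)
    show "T (vscale H c x) = vscale H c (T x)" if "x \<in> vecs H" for c x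
      by (rule vec_eqI) (use that T scalel in auto)
  qed (use T nT in \<open>auto simp: T_def\<close>)
  with T nT that show thesis by blast
qed

text \<open>The adjoint is the operator of the bounded form that sends (x, y) to the inner product
  of x with S y; conjugation turns its defining identity into the required one.\<close>

lemma adjoint_op:
  assumes S: "S \<in> bounded_ops H"
  shows adjoint_op_bounded [simp]: "adjoint_op H S \<in> bounded_ops H"
    and inner_adjoint: "x \<in> vecs H \<Longrightarrow> y \<in> vecs H \<Longrightarrow> vinner H (S x) y = vinner H x (adjoint_op H S y)"
proof -
  obtain K where K: "K \<ge> 0" "\<And>x. x \<in> vecs H \<Longrightarrow> vnorm H (S x) \<le> K * vnorm H x"
    using bounded_ops_bound[OF S] by metis
  have *: "cmod (vinner H x (S y)) \<le> K * vnorm H x * vnorm H y" if "x \<in> vecs H" "y \<in> vecs H" for x y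
    using Cauchy_Schwarz[of x "S y"] mult_left_mono[OF K(2), of y "vnorm H x"] that S
    by (simp add: mult_ac)
  obtain T where T: "T \<in> bounded_ops H"
    "\<And>x y. x \<in> vecs H \<Longrightarrow> y \<in> vecs H \<Longrightarrow> vinner H (T x) y = vinner H x (S y)"
    by (rule sesquilinear_form_operator[of "\<lambda>x y. vinner H x (S y)" K])
      (use S K * in \<open>auto simp: bounded_ops_add bounded_ops_scale\<close>)
  have eq: "vinner H (S x) y = vinner H x (T y)" if "x \<in> vecs H" "y \<in> vecs H" for x y
    using T(2)[OF that(2,1)] that S T(1) by (metis inner_commute bounded_ops_closed)
  then have "adjoint_op H S = T"
    by (intro adjoint_op_eqI S T)
  with T eq show "adjoint_op H S \<in> bounded_ops H"
    "x \<in> vecs H \<Longrightarrow> y \<in> vecs H \<Longrightarrow> vinner H (S x) y = vinner H x (adjoint_op H S y)"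
    by auto
qed

text \<open>Riesz inside \<open>U\<close>, applied to the functional y to <y, x>, which
  Cauchy-Schwarz bounds by the norm of x: the projection is the representing vector.\<close>

lemma orthogonal_projection_exists:
  assumes U: "lin_subspace H U" "norm_closure H U \<subseteq> U" and x: "x \<in> vecs H"
  obtains p where "p \<in> U" "\<And>y. y \<in> U \<Longrightarrow> vinner H x y = vinner H p y"
proof -
  interpret U: hilbert "H\<lparr>vecs := U\<rparr>" by (rule hilbert_closed_subspace[OF U])
  have UV: "y \<in> U \<Longrightarrow> y \<in> vecs H" for y using U by (auto simp: lin_subspace_def)
  obtain p where "p \<in> U" "\<And>y. y \<in> U \<Longrightarrow> vinner H y x = vinner H y p"
    by (rule U.Riesz_representation[of "\<lambda>y. vinner H y x" "vnorm H x"])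
      (use x UV Cauchy_Schwarz in \<open>auto simp: mult.commute\<close>)
  with that x UV show thesis by (metis inner_commute)
qed

end

section \<open>Orthogonal decompositions\<close>

text \<open>Totality is phrased as a trivial orthogonal complement, the form in which the moment
  argument supplies it.\<close>

locale orthogonal_decomposition = hilbert H for H :: "'a inner_space" +
  fixes W :: "'i \<Rightarrow> 'a set"
  assumes W_subspace: "lin_subspace H (W i)"
    and W_closed: "norm_closure H (W i) \<subseteq> W i"
    and W_orthogonal: "i \<noteq> j \<Longrightarrow> x \<in> W i \<Longrightarrow> y \<in> W j \<Longrightarrow> vinner H x y = 0"
    and W_total: "x \<in> vecs H \<Longrightarrow> (\<And>i w. w \<in> W i \<Longrightarrow> vinner H x w = 0) \<Longrightarrow> x = vzero H"
begin

sublocale W: hilbert "H\<lparr>vecs := W i\<rparr>" for i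
  by (rule hilbert_closed_subspace[OF W_subspace W_closed])

lemma W_vecs [simp]: "w \<in> W i \<Longrightarrow> w \<in> vecs H"
  using W_subspace[of i] by (auto simp: lin_subspace_def)

lemma W_add: "x \<in> W i \<Longrightarrow> y \<in> W i \<Longrightarrow> vadd H x y \<in> W i"
  and W_scale: "x \<in> W i \<Longrightarrow> vscale H c x \<in> W i"
  and W_zero [simp]: "vzero H \<in> W i"
  using W_subspace by (auto simp: lin_subspace_def)

lemma W_vec_eqI:
  assumes "x \<in> W i" "y \<in> W i" "\<And>w. w \<in> W i \<Longrightarrow> vinner H x w = vinner H y w"
  shows "x = y"
  using W.vec_eqI[of x i y] assms by simp

lemma total_eqI:
  assumes x: "x \<in> vecs H" and y: "y \<in> vecs H"
    and eq: "\<And>i w. w \<in> W i \<Longrightarrow> vinner H x w = vinner H y w"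
  shows "x = y"
proof (rule vdist_eq_0D[OF x y])
  have "vadd H x (vscale H (-1) y) = vzero H"
    using x y eq by (intro W_total) auto
  then show "vdist H x y = 0" by (simp add: vdist_def)
qed

section \<open>Projections onto the blocks\<close>

definition proj :: "'i \<Rightarrow> 'a \<Rightarrow> 'a"
  where "proj i x = (SOME p. p \<in> W i \<and> (\<forall>w\<in>W i. vinner H x w = vinner H p w))"

lemma proj:
  assumes "x \<in> vecs H"
  shows proj_in [simp]: "proj i x \<in> W i"
    and inner_proj: "w \<in> W i \<Longrightarrow> vinner H (proj i x) w = vinner H x w"
proof -
  obtain p where p: "p \<in> W i" "\<And>w. w \<in> W i \<Longrightarrow> vinner H x w = vinner H p w"
    using orthogonal_projection_exists[OF W_subspace W_closed assms, of i] by blast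
  have "proj i x \<in> W i \<and> (\<forall>w\<in>W i. vinner H x w = vinner H (proj i x) w)"
    unfolding proj_def by (rule someI[of _ p]) (use p in auto)
  then show "proj i x \<in> W i" "w \<in> W i \<Longrightarrow> vinner H (proj i x) w = vinner H x w"
    by auto
qed

lemma proj_vecs [simp]: "x \<in> vecs H \<Longrightarrow> proj i x \<in> vecs H"
  using W_vecs[OF proj_in] .

lemma proj_add:
  assumes "x \<in> vecs H" "y \<in> vecs H"
  shows "proj i (vadd H x y) = vadd H (proj i x) (proj i y)"
  by (rule W_vec_eqI[of _ i]) (use assms in \<open>auto simp: inner_proj W_add\<close>)

lemma proj_scale:
  assumes "x \<in> vecs H"
  shows "proj i (vscale H c x) = vscale H c (proj i x)"
  by (rule W_vec_eqI[of _ i]) (use assms in \<open>auto simp: inner_proj W_scale\<close>)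

lemma proj_ident: "w \<in> W i \<Longrightarrow> proj i w = w"
  by (rule W_vec_eqI[of _ i]) (auto simp: inner_proj)

lemma proj_other: "w \<in> W j \<Longrightarrow> i \<noteq> j \<Longrightarrow> proj i w = vzero H"
  by (rule W_vec_eqI[of _ i]) (auto simp: inner_proj W_orthogonal[of j i])

text \<open>\<open>x\<close> and its projection to \<open>W i\<close> have the same inner products
  with every block: by definition with \<open>W i\<close>, and 0 with the others. Serves to identify
  the eigenspaces and to show that adjoints keep the blocks.\<close>

lemma mem_W_I:
  assumes x: "x \<in> vecs H" and orth: "\<And>j w. j \<noteq> i \<Longrightarrow> w \<in> W j \<Longrightarrow> vinner H x w = 0"
  shows "x \<in> W i"
proof -
  have "x = proj i x"
  proof (rule total_eqI)
    fix j w assume w: "w \<in> W j"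
    show "vinner H x w = vinner H (proj i x) w"
      using x w orth[of j w] W_orthogonal[of i j "proj i x" w] by (cases "j = i") (auto simp: inner_proj)
  qed (use x in auto)
  then show ?thesis using proj_in[OF x, of i] by simp
qed

text \<open>The sum s of finitely many projections of x satisfies <x, s> = |s|^2, so Cauchy-Schwarz
  bounds |s| by |x|.\<close>

lemma Bessel:
  assumes x: "x \<in> vecs H" and "finite F"
  shows "(\<Sum>i\<in>F. (vnorm H (proj i x))\<^sup>2) \<le> (vnorm H x)\<^sup>2"
proof -
  let ?b = "\<lambda>F. \<Sum>i\<in>F. (vnorm H (proj i x))\<^sup>2"
  \<comment> \<open>The witness is the sum of the projections with index in F, carried through the
    induction by its properties. The last clause makes the next projection orthogonal to it.\<close>
  have "\<exists>s\<in>vecs H. vinner H s s = of_real (?b F) \<and> vinner H x s = of_real (?b F) \<and>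
      (\<forall>i w. i \<notin> F \<longrightarrow> w \<in> W i \<longrightarrow> vinner H s w = 0)"
    using \<open>finite F\<close>
  proof induction
    case empty
    show ?case using x by (intro bexI[of _ "vzero H"]) auto
  next
    case (insert i F)
    then obtain s where s: "s \<in> vecs H" "vinner H s s = of_real (?b F)" "vinner H x s = of_real (?b F)"
      "\<And>i w. i \<notin> F \<Longrightarrow> w \<in> W i \<Longrightarrow> vinner H s w = 0" by blast
    let ?p = "proj i x"
    have p: "?p \<in> vecs H" "vinner H s ?p = 0" "vinner H ?p s = 0"
      using x s insert(2) inner_commute[of s ?p] by auto
    have "vinner H ?p ?p = of_real ((vnorm H ?p)\<^sup>2)" "vinner H x ?p = of_real ((vnorm H ?p)\<^sup>2)"
      using inner_self[OF p(1)] inner_proj[OF x, of ?p i] x by auto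
    moreover have "vinner H ?p w = 0" if "j \<noteq> i" "w \<in> W j" for j w
      using W_orthogonal[of i j ?p w] that x by auto
    ultimately show ?case
      using x s p insert(1,2)
      by (intro bexI[of _ "vadd H s ?p"]) auto
  qed
  then obtain s where s: "s \<in> vecs H" "vinner H s s = of_real (?b F)" "vinner H x s = of_real (?b F)"
    by blast
  have ns: "(vnorm H s)\<^sup>2 = ?b F" using s by (simp add: vnorm_sq)
  then have "cmod (vinner H x s) = (vnorm H s)\<^sup>2"
    using s(3) by (metis norm_of_real abs_of_nonneg zero_le_power2)
  then have "vnorm H s * vnorm H s \<le> vnorm H x * vnorm H s"
    using Cauchy_Schwarz[OF x s(1)] by (simp add: power2_eq_square)
  then have "vnorm H s \<le> vnorm H x"
    using vnorm_nonneg[OF s(1)] vnorm_nonneg[OF x]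
    by (cases "vnorm H s = 0") (auto simp: mult_le_cancel_right)
  then show ?thesis
    using ns power_mono[of "vnorm H s" "vnorm H x" 2] s by simp
qed

text \<open>Agreement on the blocks makes the adjoints pass the same tests against each block, so
  totality equates the adjoints and thereby the operators. The detour replaces density of the sums
  from the blocks.\<close>

lemma bounded_ops_eq_on_W:
  assumes S: "S \<in> bounded_ops H" and T: "T \<in> bounded_ops H"
    and eq: "\<And>i w. w \<in> W i \<Longrightarrow> S w = T w"
  shows "S = T"
proof (rule bounded_ops_eqI[OF S T])
  fix x assume x: "x \<in> vecs H"
  have adj: "adjoint_op H S y = adjoint_op H T y" if y: "y \<in> vecs H" for y
  proof (rule total_eqI)
    fix i w assume w: "w \<in> W i"
    then have "vinner H w (adjoint_op H S y) = vinner H w (adjoint_op H T y)"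
      using eq[OF w] inner_adjoint[OF S _ y, of w] inner_adjoint[OF T _ y, of w] by simp
    then show "vinner H (adjoint_op H S y) w = vinner H (adjoint_op H T y) w"
      using w y S T by (metis W_vecs adjoint_op_bounded bounded_ops_closed inner_commute)
  qed (use S T y in auto)
  show "S x = T x"
    by (rule vec_eqI) (use S T x adj in \<open>auto simp: inner_adjoint\<close>)
qed

section \<open>Operators that keep every block\<close>

definition invariant_ops :: "('a \<Rightarrow> 'a) set"
  where "invariant_ops = {S \<in> bounded_ops H. \<forall>i. S ` W i \<subseteq> W i}"

lemma invariant_opsD: "S \<in> invariant_ops \<Longrightarrow> S \<in> bounded_ops H"
  "S \<in> invariant_ops \<Longrightarrow> w \<in> W i \<Longrightarrow> S w \<in> W i"
  by (auto simp: invariant_ops_def)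

text \<open>For w in another block, pairing w with the adjoint at y equals <S w, y>, which is 0
  because S w stays in that other block.\<close>

lemma adjoint_invariant:
  assumes S: "S \<in> invariant_ops" shows "adjoint_op H S \<in> invariant_ops"
proof -
  note Sb = invariant_opsD(1)[OF S]
  have "adjoint_op H S y \<in> W i" if y: "y \<in> W i" for i y
  proof (rule mem_W_I)
    fix j w assume j: "j \<noteq> i" and w: "w \<in> W j"
    have "vinner H w (adjoint_op H S y) = 0"
      using inner_adjoint[OF Sb, of w y] W_orthogonal[OF j invariant_opsD(2)[OF S w] y] w y by simp
    then show "vinner H (adjoint_op H S y) w = 0"
      using inner_commute[of w "adjoint_op H S y"] Sb w y by simp
  qed (use Sb y in auto)
  with Sb show ?thesis by (auto simp: invariant_ops_def)
qed

lemma restrict_bounded_op: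
  assumes S: "S \<in> invariant_ops"
  shows "restrict S (W i) \<in> bounded_ops (H\<lparr>vecs := W i\<rparr>)"
    and "op_norm (H\<lparr>vecs := W i\<rparr>) (restrict S (W i)) \<le> op_norm H S"
proof -
  note Sb = invariant_opsD(1)[OF S]
  have b: "vnorm H (S x) \<le> op_norm H S * vnorm H x" if "x \<in> W i" for x
    using op_norm_bound[OF Sb] that by simp
  then show "restrict S (W i) \<in> bounded_ops (H\<lparr>vecs := W i\<rparr>)"
    using invariant_opsD[OF S]
    by (intro W.bounded_opsI[of _ _ "op_norm H S"])
      (auto simp: W_add W_scale bounded_ops_add bounded_ops_scale)
  show "op_norm (H\<lparr>vecs := W i\<rparr>) (restrict S (W i)) \<le> op_norm H S"
    by (rule W.op_norm_le) (use b op_norm_nonneg[OF Sb] in auto)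
qed

text \<open>The operator glued from the blocks is obtained weakly, from the sesquilinear form
  \<open>\<Sum>\<^sub>i \<langle>A\<^sub>i (P\<^sub>i x), P\<^sub>i y\<rangle>\<close>, so that no series of vectors has to be summed.\<close>

lemma glue_blocks:
  assumes A: "\<And>i. A i \<in> bounded_ops (H\<lparr>vecs := W i\<rparr>)"
    and M: "\<And>i. op_norm (H\<lparr>vecs := W i\<rparr>) (A i) \<le> M"
  obtains S where "S \<in> invariant_ops" "\<And>i. restrict S (W i) = A i" "op_norm H S \<le> M"
proof -
  note A_closed = W.bounded_ops_closed[OF A, simplified]
  have "M \<ge> 0" using W.op_norm_nonneg[OF A] M order_trans by blast
  \<comment> \<open>Projections of a block vector to other blocks are \<open>vzero H\<close>, and
    their terms of the form must vanish. The norm bound at the zero vector gives this.\<close>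
  have A0: "A i (vzero H) = vzero H" for i
  proof (rule vnorm_eq_0D)
    show *: "A i (vzero H) \<in> vecs H" by (rule W_vecs[OF A_closed]) simp
    show "vnorm H (A i (vzero H)) = 0"
      using W.op_norm_bound[OF A, of "vzero H" i] vnorm_nonneg[OF *] by simp
  qed
  define g where "g x y i = vinner H (A i (proj i x)) (proj i y)" for x y i
  define B where "B x y = infsum (g x y) UNIV" for x y
  \<comment> \<open>Cauchy-Schwarz in each block, then Cauchy-Schwarz for sums, then Bessel for x
    and for y. The bound is uniform in F, which gives absolute summability as well as the bound M of
    the form.\<close>
  have g_bound: "(\<Sum>i\<in>F. cmod (g x y i)) \<le> M * vnorm H x * vnorm H y"
    if x: "x \<in> vecs H" and y: "y \<in> vecs H" and F: "finite F" for x y F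
  proof -
    let ?a = "\<lambda>i. vnorm H (proj i x)" and ?b = "\<lambda>i. vnorm H (proj i y)"
    have "cmod (g x y i) \<le> M * (\<bar>?a i\<bar> * \<bar>?b i\<bar>)" for i
    proof -
      have "vnorm H (A i (proj i x)) \<le> op_norm (H\<lparr>vecs := W i\<rparr>) (A i) * ?a i"
        using W.op_norm_bound[OF A, of "proj i x" i] x by simp
      also have "\<dots> \<le> M * ?a i"
        using M x by (intro mult_right_mono) auto
      finally have "vnorm H (A i (proj i x)) * ?b i \<le> M * ?a i * ?b i"
        using y by (intro mult_right_mono) auto
      moreover have "cmod (g x y i) \<le> vnorm H (A i (proj i x)) * ?b i"
        unfolding g_def using x y W_vecs[OF A_closed] by (intro Cauchy_Schwarz) auto
      ultimately show ?thesis using x y by simp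
    qed
    then have "(\<Sum>i\<in>F. cmod (g x y i)) \<le> M * (\<Sum>i\<in>F. \<bar>?a i\<bar> * \<bar>?b i\<bar>)"
      unfolding sum_distrib_left by (rule sum_mono)
    also have "\<dots> \<le> M * (L2_set ?a F * L2_set ?b F)"
      using \<open>M \<ge> 0\<close> by (intro mult_left_mono L2_set_mult_ineq)
    also have "\<dots> \<le> M * (vnorm H x * vnorm H y)"
      using \<open>M \<ge> 0\<close> x y F Bessel
      by (intro mult_left_mono mult_mono) (auto simp: L2_set_def intro!: real_le_lsqrt sum_nonneg)
    finally show ?thesis by simp
  qed
  have g_abs: "(\<lambda>i. cmod (g x y i)) summable_on UNIV" if "x \<in> vecs H" "y \<in> vecs H" for x y
    using g_bound[OF that]
    by (intro nonneg_bdd_above_summable_on) (auto intro!: bdd_aboveI)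
  note g_sum = abs_summable_summable[OF g_abs]
  obtain S where S: "S \<in> bounded_ops H"
    "\<And>x y. x \<in> vecs H \<Longrightarrow> y \<in> vecs H \<Longrightarrow> vinner H (S x) y = B x y"
    "\<And>x. x \<in> vecs H \<Longrightarrow> vnorm H (S x) \<le> M * vnorm H x"
  proof (rule sesquilinear_form_operator[of B M])
    fix x y z c assume x: "x \<in> vecs H" and y: "y \<in> vecs H"
    show "cmod (B x y) \<le> M * vnorm H x * vnorm H y"
      unfolding B_def
      by (rule order_trans[OF norm_infsum_bound infsum_le_finite_sums])
        (use x y g_abs g_bound in auto)
    have "g (vscale H c x) y = (\<lambda>i. c * g x y i)" "g x (vscale H c y) = (\<lambda>i. cnj c * g x y i)"
      using x y W_vecs[OF A_closed] W.bounded_ops_scale[OF A]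
      by (auto simp: g_def fun_eq_iff proj_scale)
    then show "B (vscale H c x) y = c * B x y" "B x (vscale H c y) = cnj c * B x y"
      by (simp_all add: B_def infsum_cmult_right')
    assume z: "z \<in> vecs H"
    have "g (vadd H x y) z = (\<lambda>i. g x z i + g y z i)" "g x (vadd H y z) = (\<lambda>i. g x y i + g x z i)"
      using x y z W_vecs[OF A_closed] W.bounded_ops_add[OF A]
      by (auto simp: g_def fun_eq_iff proj_add)
    then show "B (vadd H x y) z = B x z + B y z" "B x (vadd H y z) = B x y + B x z"
      using x y z by (simp_all add: B_def infsum_add g_sum)
  qed (use \<open>M \<ge> 0\<close> in auto)
  \<comment> \<open>For w in \<open>W i\<close> only the term with index i survives; tests v from
    another block give 0 on both sides by orthogonality.\<close>
  have SA: "S w = A i w" if w: "w \<in> W i" for i w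
  proof (rule total_eqI)
    fix j v assume v: "v \<in> W j"
    have "g w v k = 0" if "k \<noteq> i" for k
      using proj_other[OF w that] v A0 by (simp add: g_def)
    then have "B w v = infsum (g w v) {i}"
      unfolding B_def by (intro infsum_cong_neutral) auto
    also have "\<dots> = g w v i" by simp
    also have "\<dots> = vinner H (A i w) v"
      using w v A_closed[OF w] W_orthogonal[of i j "A i w" v] proj_other[OF v, of i]
      by (cases "i = j") (auto simp: g_def proj_ident)
    finally show "vinner H (S w) v = vinner H (A i w) v"
      using S w v by simp
  qed (use S w W_vecs[OF A_closed[OF w]] in auto)
  show thesis
  proof
    show "S \<in> invariant_ops" using S SA A_closed by (auto simp: invariant_ops_def)
    show "restrict S (W i) = A i" for i
      using SA W.bounded_ops_extensional[OF A, of i] by (auto simp: fun_eq_iff restrict_def extensional_def)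
    show "op_norm H S \<le> M" using S \<open>M \<ge> 0\<close> by (intro op_norm_le)
  qed
qed

definition blocks :: "('a \<Rightarrow> 'a) \<Rightarrow> 'i \<Rightarrow> 'a \<Rightarrow> 'a"
  where "blocks S i = restrict S (W i)"

text \<open>Restriction does not increase the norm. For the converse the blocks of S are glued
  again: the result has norm at most the supremum and agrees with S on all blocks, so it is
  S.\<close>

lemma op_norm_blocks:
  assumes S: "S \<in> invariant_ops"
  shows "bdd_above (range (\<lambda>i. op_norm (H\<lparr>vecs := W i\<rparr>) (blocks S i)))"
    and "(SUP i. op_norm (H\<lparr>vecs := W i\<rparr>) (blocks S i)) = op_norm H S"
proof -
  let ?n = "\<lambda>i. op_norm (H\<lparr>vecs := W i\<rparr>) (blocks S i)"
  show bdd: "bdd_above (range ?n)"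
    using restrict_bounded_op(2)[OF S] by (auto simp: blocks_def intro!: bdd_aboveI)
  obtain T where T: "T \<in> invariant_ops" "\<And>i. restrict T (W i) = blocks S i" "op_norm H T \<le> (SUP i. ?n i)"
    by (rule glue_blocks[of "blocks S" "SUP i. ?n i"])
      (auto simp: blocks_def restrict_bounded_op[OF S] bdd[unfolded blocks_def] intro!: cSUP_upper)
  have "T = S"
  proof (rule bounded_ops_eq_on_W)
    fix i w assume "w \<in> W i"
    then show "T w = S w" using fun_cong[OF T(2)[of i], of w] by (simp add: blocks_def)
  qed (use T S invariant_opsD in auto)
  moreover have "(SUP i. ?n i) \<le> op_norm H S"
    using restrict_bounded_op(2)[OF S] by (intro cSUP_least) (auto simp: blocks_def)
  ultimately show "(SUP i. ?n i) = op_norm H S" using T(3) by simp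
qed

text \<open>Injectivity is \<open>bounded_ops_eq_on_W\<close> and surjectivity is
  \<open>glue_blocks\<close>. Blocks are extensional, so the algebraic laws are checked pointwise;
  for products the right factor has to keep each block.\<close>

theorem blocks_isometric_star_iso:
  "blocks \<in> isometric_star_iso ((operator_algebra H)\<lparr>carrier := invariant_ops\<rparr>)
    (direct_sum (\<lambda>i. operator_algebra (H\<lparr>vecs := W i\<rparr>)))"
  (is "_ \<in> isometric_star_iso ?A ?B")
proof -
  note inv = invariant_opsD
  have closed: "blocks S \<in> carrier ?B" if "S \<in> invariant_ops" for S
    using restrict_bounded_op(1)[OF that] op_norm_blocks(1)[OF that]
    by (simp add: direct_sum_def operator_algebra_def blocks_def)
  have bij: "bij_betw blocks invariant_ops (carrier ?B)"
  proof (rule bij_betw_imageI)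
    show "inj_on blocks invariant_ops"
    proof (rule inj_onI)
      fix S T assume S: "S \<in> invariant_ops" and T: "T \<in> invariant_ops" and eq: "blocks S = blocks T"
      show "S = T"
      proof (rule bounded_ops_eq_on_W)
        fix i w assume "w \<in> W i"
        then show "S w = T w" using fun_cong[OF fun_cong[OF eq, of i], of w] by (simp add: blocks_def)
      qed (use S T inv in auto)
    qed
    show "blocks ` invariant_ops = carrier ?B"
    proof
      show "carrier ?B \<subseteq> blocks ` invariant_ops"
      proof
        fix F assume "F \<in> carrier ?B"
        then have F: "\<And>i. F i \<in> bounded_ops (H\<lparr>vecs := W i\<rparr>)"
          "bdd_above (range (\<lambda>i. op_norm (H\<lparr>vecs := W i\<rparr>) (F i)))"
          by (auto simp: direct_sum_def operator_algebra_def)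
        obtain S where "S \<in> invariant_ops" "\<And>i. restrict S (W i) = F i"
          by (rule glue_blocks[OF F(1) cSUP_upper[OF UNIV_I F(2)]]) blast
        then show "F \<in> blocks ` invariant_ops"
          by (intro image_eqI[of _ _ S]) (auto simp: blocks_def fun_eq_iff)
      qed
    qed (use closed in auto)
  qed
  have iso: "blocks \<in> ring_iso ?A ?B"
  proof (rule ring_iso_memI)
    show "\<And>S. S \<in> carrier ?A \<Longrightarrow> blocks S \<in> carrier ?B" using closed by simp
    show "bij_betw blocks (carrier ?A) (carrier ?B)" using bij by simp
    show "blocks \<one>\<^bsub>?A\<^esub> = \<one>\<^bsub>?B\<^esub>"
      by (auto simp: blocks_def operator_algebra_def direct_sum_def fun_eq_iff restrict_def)
    fix S T assume "S \<in> carrier ?A" "T \<in> carrier ?A"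
    then have S: "S \<in> invariant_ops" and T: "T \<in> invariant_ops" by auto
    show "blocks (S \<otimes>\<^bsub>?A\<^esub> T) = blocks S \<otimes>\<^bsub>?B\<^esub> blocks T"
      using inv[OF T]
      by (auto simp: blocks_def operator_algebra_def direct_sum_def fun_eq_iff restrict_def compose_def)
    show "blocks (S \<oplus>\<^bsub>?A\<^esub> T) = blocks S \<oplus>\<^bsub>?B\<^esub> blocks T"
      by (auto simp: blocks_def operator_algebra_def direct_sum_def fun_eq_iff restrict_def)
  qed
  have adj: "blocks (adjoint_op H S) i = adjoint_op (H\<lparr>vecs := W i\<rparr>) (blocks S i)"
    if S: "S \<in> invariant_ops" for S i
    unfolding blocks_def
    by (rule W.adjoint_op_eqI[symmetric])
      (use restrict_bounded_op(1) S adjoint_invariant[OF S] inner_adjoint[OF inv(1)[OF S]] in auto)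
  show ?thesis
    unfolding isometric_star_iso_def mem_Collect_eq
  proof (intro conjI ballI allI iso)
    fix S assume "S \<in> carrier ?A"
    then have S: "S \<in> invariant_ops" by simp
    show "blocks (c \<odot>\<^bsub>?A\<^esub> S) = c \<odot>\<^bsub>?B\<^esub> blocks S" for c
      by (auto simp: blocks_def operator_algebra_def direct_sum_def fun_eq_iff restrict_def)
    show "blocks (star ?A S) = star ?B (blocks S)"
      using adj[OF S] by (simp add: operator_algebra_def direct_sum_def fun_eq_iff)
    show "anorm ?B (blocks S) = anorm ?A S"
      using op_norm_blocks(2)[OF S] by (simp add: operator_algebra_def direct_sum_def)
  qed
qed

end

section \<open>Commutants as von Neumann algebras\<close>

context hilbert
begin

lemma commutant_antimono: "M \<subseteq> N \<Longrightarrow> commutant H N \<subseteq> commutant H M"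
  by (auto simp: commutant_def)

text \<open>Taking commutants is an antitone Galois connection, so the third commutant of G equals
  the first.\<close>

lemma von_neumann_algebra_commutant:
  assumes G: "G \<subseteq> bounded_ops H"
    and adj: "\<And>S. S \<in> commutant H G \<Longrightarrow> adjoint_op H S \<in> commutant H G"
  shows "von_neumann_algebra H (commutant H G)"
proof -
  have bi: "M \<subseteq> commutant H (commutant H M)" if "M \<subseteq> bounded_ops H" for M
    using that by (auto simp: commutant_def subset_iff)
  have sub: "commutant H G \<subseteq> bounded_ops H" by (auto simp: commutant_def)
  have "commutant H (commutant H (commutant H G)) = commutant H G"
    using commutant_antimono[OF bi[OF G]] bi[OF sub] by blast
  with sub adj show ?thesis by (simp add: von_neumann_algebra_def)
qed

end

section \<open>Square integrable functions\<close>

lemma integrable_norm_diff_sq: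
  fixes f g :: "'a \<Rightarrow> complex"
  assumes [measurable]: "f \<in> borel_measurable M" "g \<in> borel_measurable M"
    and "integrable M (\<lambda>x. (cmod (f x))\<^sup>2)" "integrable M (\<lambda>x. (cmod (g x))\<^sup>2)"
  shows "integrable M (\<lambda>x. (cmod (f x - g x))\<^sup>2)"
proof (rule Bochner_Integration.integrable_bound)
  show "integrable M (\<lambda>x. 2 * (cmod (f x))\<^sup>2 + 2 * (cmod (g x))\<^sup>2)"
    using assms by auto
  have "(cmod (a - b))\<^sup>2 \<le> 2 * (cmod a)\<^sup>2 + 2 * (cmod b)\<^sup>2" for a b
  proof -
    have "(cmod (a - b))\<^sup>2 \<le> (cmod a + cmod b)\<^sup>2"
      by (intro power_mono norm_triangle_ineq4) simp
    also have "\<dots> \<le> 2 * (cmod a)\<^sup>2 + 2 * (cmod b)\<^sup>2"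
      using zero_le_power2[of "cmod a - cmod b"] by (simp add: power2_eq_square algebra_simps)
    finally show ?thesis .
  qed
  then show "AE x in M. norm ((cmod (f x - g x))\<^sup>2) \<le> norm (2 * (cmod (f x))\<^sup>2 + 2 * (cmod (g x))\<^sup>2)"
    by (simp add: add_nonneg_nonneg)
qed measurable

text \<open>Weighted AM-GM: d <= (2^-k + 2^k d^2)/2, so the increments are absolutely summable, and
  they telescope to u.\<close>

lemma summable_imp_convergent_increments:
  fixes u :: "nat \<Rightarrow> complex"
  assumes "summable (\<lambda>k. 2 ^ k * (cmod (u (Suc k) - u k))\<^sup>2)"
  shows "convergent u"
proof -
  have "summable (\<lambda>k. u (Suc k) - u k)"
  proof (rule summable_comparison_test')
    show "summable (\<lambda>k. ((1/2) ^ k + 2 ^ k * (cmod (u (Suc k) - u k))\<^sup>2) / 2)"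
      using assms by (intro summable_divide summable_add summable_geometric) auto
    fix k :: nat
    let ?d = "cmod (u (Suc k) - u k)"
    have "0 \<le> 2 ^ k * (?d - (1/2) ^ k)\<^sup>2" by simp
    also have "\<dots> = 2 ^ k * ?d\<^sup>2 - 2 * ?d * (2 ^ k * (1/2) ^ k) + (2 ^ k * (1/2) ^ k) * (1/2) ^ k"
      by (simp only: power2_eq_square algebra_simps)
    also have "2 ^ k * (1/2) ^ k = (1::real)" by (simp flip: power_mult_distrib)
    finally show "?d \<le> ((1/2) ^ k + 2 ^ k * ?d\<^sup>2) / 2" by simp
  qed
  then have "convergent (\<lambda>n. \<Sum>k<n. u (Suc k) - u k)"
    by (simp add: summable_iff_convergent)
  then have "convergent (\<lambda>n. (u n - u 0) + u 0)"
    by (intro convergent_add convergent_const) (simp add: sum_lessThan_telescope)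
  then show ?thesis by simp
qed

lemma AE_summable_of_nn_integral:
  fixes h :: "nat \<Rightarrow> 'a \<Rightarrow> real"
  assumes [measurable]: "\<And>k. h k \<in> borel_measurable M" and nn: "\<And>k x. 0 \<le> h k x"
    and "(\<Sum>k. \<integral>\<^sup>+x. ennreal (h k x) \<partial>M) < \<infinity>"
  shows "AE x in M. summable (\<lambda>k. h k x)"
proof -
  have "(\<integral>\<^sup>+x. (\<Sum>k. ennreal (h k x)) \<partial>M) \<noteq> \<infinity>"
    using assms(3) by (subst nn_integral_suminf) auto
  then have "AE x in M. (\<Sum>k. ennreal (h k x)) \<noteq> \<infinity>"
    by (intro nn_integral_PInf_AE) auto
  then show ?thesis
    by eventually_elim (intro summable_suminf_not_top, use nn in auto)
qed

text \<open>A sparse subsequence converges almost everywhere; Fatou's lemma then transfers the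
  Cauchy estimate of the whole sequence to the limit.\<close>

theorem Riesz_Fischer:
  fixes f :: "nat \<Rightarrow> 'a \<Rightarrow> complex"
  assumes meas [measurable]: "\<And>n. f n \<in> borel_measurable M"
    and int: "\<And>n. integrable M (\<lambda>x. (cmod (f n x))\<^sup>2)"
    and Cauchy: "\<And>e. e > 0 \<Longrightarrow> \<exists>N. \<forall>m\<ge>N. \<forall>n\<ge>N. (LINT x|M. (cmod (f m x - f n x))\<^sup>2) < e"
  obtains g where "g \<in> borel_measurable M" "integrable M (\<lambda>x. (cmod (g x))\<^sup>2)"
    "(\<lambda>n. LINT x|M. (cmod (f n x - g x))\<^sup>2) \<longlonglongrightarrow> 0"
proof -
  let ?I = "\<lambda>m n. LINT x|M. (cmod (f m x - f n x))\<^sup>2"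
  note intd = integrable_norm_diff_sq[OF meas meas int int]
  have nnI: "(\<integral>\<^sup>+x. ennreal ((cmod (f m x - f n x))\<^sup>2) \<partial>M) = ennreal (?I m n)" for m n
    by (rule nn_integral_eq_integral[OF intd]) simp
  \<comment> \<open>Against the weights 2^k of the increment criterion, the rate (1/4)^k leaves the
    summable (1/2)^k.\<close>
  obtain N where N: "\<And>k m n. m \<ge> N k \<Longrightarrow> n \<ge> N k \<Longrightarrow> ?I m n < (1/4) ^ k"
    using Cauchy[of "(1/4) ^ k" for k] by (metis zero_less_power zero_less_divide_1_iff zero_less_numeral)
  \<comment> \<open>The partial sum of N puts both r k and r (k+1) beyond N k; the summand k makes r
    unbounded.\<close>
  define r where "r k = (\<Sum>j\<le>k. N j) + k" for k
  have r_ge: "r k \<ge> N k" "r k \<ge> k" "r (Suc k) \<ge> N k" for k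
    using member_le_sum[of k "{..k}" N] by (auto simp: r_def)
  have "AE x in M. summable (\<lambda>k. 2 ^ k * (cmod (f (r (Suc k)) x - f (r k) x))\<^sup>2)"
  proof (rule AE_summable_of_nn_integral)
    have "(\<integral>\<^sup>+x. ennreal (2 ^ k * (cmod (f (r (Suc k)) x - f (r k) x))\<^sup>2) \<partial>M) \<le> ennreal ((1/2) ^ k)" for k
    proof -
      have "(\<integral>\<^sup>+x. ennreal (2 ^ k * (cmod (f (r (Suc k)) x - f (r k) x))\<^sup>2) \<partial>M)
        = ennreal (2 ^ k * ?I (r (Suc k)) (r k))"
        by (subst nn_integral_eq_integral) (auto intro!: integrable_mult_right intd)
      also have "2 ^ k * ?I (r (Suc k)) (r k) \<le> 2 ^ k * (1/4) ^ k"
        using N[OF r_ge(3,1), of k] by simp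
      also have "2 ^ k * (1/4) ^ k = (1/2 :: real) ^ k"
        by (simp flip: power_mult_distrib)
      finally show ?thesis by (simp add: ennreal_leI)
    qed
    then have "(\<Sum>k. \<integral>\<^sup>+x. ennreal (2 ^ k * (cmod (f (r (Suc k)) x - f (r k) x))\<^sup>2) \<partial>M) \<le> (\<Sum>k. ennreal ((1/2) ^ k))"
      by (intro suminf_le) auto
    also have "\<dots> = ennreal (\<Sum>k. (1/2) ^ k)"
      by (intro suminf_ennreal2 summable_geometric) auto
    also have "\<dots> < \<infinity>" by simp
    finally show "(\<Sum>k. \<integral>\<^sup>+x. ennreal (2 ^ k * (cmod (f (r (Suc k)) x - f (r k) x))\<^sup>2) \<partial>M) < \<infinity>" .
  qed auto
  then have conv: "AE x in M. convergent (\<lambda>k. f (r k) x)"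
    by eventually_elim (rule summable_imp_convergent_increments)
  \<comment> \<open>Where the subsequence diverges, \<open>lim\<close> is an unspecified value, but
    this happens only on a null set and g is still measurable.\<close>
  define g where "g x = lim (\<lambda>k. f (r k) x)" for x
  have g [measurable]: "g \<in> borel_measurable M"
    unfolding g_def by (rule borel_measurable_lim_metric) auto
  \<comment> \<open>Fatou along m = r k with n fixed.\<close>
  have bound: "(\<integral>\<^sup>+x. ennreal ((cmod (f n x - g x))\<^sup>2) \<partial>M) \<le> ennreal e"
    if e: "\<And>m. m \<ge> K \<Longrightarrow> ?I n m \<le> e" for n K e
  proof -
    have "AE x in M. ennreal ((cmod (f n x - g x))\<^sup>2) = liminf (\<lambda>k. ennreal ((cmod (f n x - f (r k) x))\<^sup>2))"
      using conv
    proof eventually_elim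
      case (elim x)
      then have "(\<lambda>k. f (r k) x) \<longlonglongrightarrow> g x" by (simp add: g_def convergent_LIMSEQ_iff)
      then have "(\<lambda>k. ennreal ((cmod (f n x - f (r k) x))\<^sup>2)) \<longlonglongrightarrow> ennreal ((cmod (f n x - g x))\<^sup>2)"
        by (intro tendsto_intros)
      then show ?case by (intro lim_imp_Liminf[symmetric]) auto
    qed
    then have "(\<integral>\<^sup>+x. ennreal ((cmod (f n x - g x))\<^sup>2) \<partial>M) =
        (\<integral>\<^sup>+x. liminf (\<lambda>k. ennreal ((cmod (f n x - f (r k) x))\<^sup>2)) \<partial>M)"
      by (rule nn_integral_cong_AE)
    also have "\<dots> \<le> liminf (\<lambda>k. \<integral>\<^sup>+x. ennreal ((cmod (f n x - f (r k) x))\<^sup>2) \<partial>M)"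
      by (rule nn_integral_liminf) auto
    also have "\<dots> = liminf (\<lambda>k. ennreal (?I n (r k)))" by (simp only: nnI)
    also have "\<dots> \<le> liminf (\<lambda>k. ennreal e)"
    proof (rule Liminf_mono, rule eventually_sequentiallyI[of K])
      fix k assume "K \<le> k"
      then show "ennreal (?I n (r k)) \<le> ennreal e"
        using e[of "r k"] r_ge(2)[of k] by (simp add: ennreal_leI)
    qed
    also have "\<dots> = ennreal e" by (simp add: Liminf_const)
    finally show ?thesis .
  qed
  \<comment> \<open>N 0 belongs to the rate (1/4)^0 = 1: from there on the differences have integral
    below 1, so the limit has integral at most 1.\<close>
  have intdg: "integrable M (\<lambda>x. (cmod (f n x - g x))\<^sup>2)" if "n \<ge> N 0" for n
  proof (rule integrableI_nonneg)
    have "(\<integral>\<^sup>+x. ennreal ((cmod (f n x - g x))\<^sup>2) \<partial>M) \<le> ennreal 1"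
      using N[of 0 n] that by (intro bound[of "N 0"]) (auto intro: less_imp_le)
    then show "(\<integral>\<^sup>+x. ennreal ((cmod (f n x - g x))\<^sup>2) \<partial>M) < \<infinity>"
      by (rule le_less_trans) simp
  qed auto
  show thesis
  proof (rule that[OF g])
    have "integrable M (\<lambda>x. (cmod (f (N 0) x - (f (N 0) x - g x)))\<^sup>2)"
      by (intro integrable_norm_diff_sq int intdg) auto
    then show "integrable M (\<lambda>x. (cmod (g x))\<^sup>2)" by simp
    show "(\<lambda>n. LINT x|M. (cmod (f n x - g x))\<^sup>2) \<longlonglongrightarrow> 0"
    proof (rule LIMSEQ_I)
      fix e :: real assume "e > 0"
      then obtain L where L: "\<And>m n. m \<ge> L \<Longrightarrow> n \<ge> L \<Longrightarrow> ?I m n < e/2"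
        using Cauchy[of "e/2"] by auto
      have "norm ((LINT x|M. (cmod (f n x - g x))\<^sup>2) - 0) < e" if n: "n \<ge> max L (N 0)" for n
      proof -
        have "ennreal (LINT x|M. (cmod (f n x - g x))\<^sup>2) = (\<integral>\<^sup>+x. ennreal ((cmod (f n x - g x))\<^sup>2) \<partial>M)"
          using intdg n by (intro nn_integral_eq_integral[symmetric]) auto
        also have "\<dots> \<le> ennreal (e/2)"
          using L[of n] n by (intro bound[of L]) (auto intro: less_imp_le)
        finally have "(LINT x|M. (cmod (f n x - g x))\<^sup>2) \<le> e/2"
          using \<open>e > 0\<close> by (simp add: ennreal_le_iff)
        then show ?thesis using \<open>e > 0\<close> by (simp add: integral_nonneg_AE)
      qed
      then show "\<exists>no. \<forall>n\<ge>no. norm ((LINT x|M. (cmod (f n x - g x))\<^sup>2) - 0) < e" by blast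
    qed
  qed
qed

section \<open>The weighted space as a Hilbert space\<close>

lemma space_disk_measure [simp]: "space (disk_measure \<alpha>) = ball 0 1"
  by (simp add: disk_measure_def space_restrict_space)

lemma sets_disk_measure [measurable_cong]:
  "sets (disk_measure \<alpha>) = sets (restrict_space borel (ball 0 1))"
  by (simp add: disk_measure_def sets_restrict_space)

lemma sq_integrableD [measurable_dest]: "f \<in> sq_integrable \<alpha> \<Longrightarrow> f \<in> borel_measurable (disk_measure \<alpha>)"
  and sq_integrable_integrable: "f \<in> sq_integrable \<alpha> \<Longrightarrow> integrable (disk_measure \<alpha>) (\<lambda>z. (cmod (f z))\<^sup>2)"
  by (auto simp: sq_integrable_def)

lemma sq_integrable_zero [simp]: "(\<lambda>z. 0) \<in> sq_integrable \<alpha>"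
  by (simp add: sq_integrable_def)

lemma sq_integrable_scale [simp]:
  assumes "f \<in> sq_integrable \<alpha>" shows "(\<lambda>z. c * f z) \<in> sq_integrable \<alpha>"
  using assms by (auto simp: sq_integrable_def norm_mult power_mult_distrib)

lemma sq_integrable_diff [simp]:
  assumes "f \<in> sq_integrable \<alpha>" "g \<in> sq_integrable \<alpha>"
  shows "(\<lambda>z. f z - g z) \<in> sq_integrable \<alpha>"
  using assms integrable_norm_diff_sq[of f "disk_measure \<alpha>" g] by (auto simp: sq_integrable_def)

lemma sq_integrable_add [simp]:
  assumes "f \<in> sq_integrable \<alpha>" "g \<in> sq_integrable \<alpha>"
  shows "(\<lambda>z. f z + g z) \<in> sq_integrable \<alpha>"
  using sq_integrable_diff[OF assms(1) sq_integrable_scale[OF assms(2), of "-1"]] by simp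

lemma sq_integrable_minus [simp]: "f \<in> sq_integrable \<alpha> \<Longrightarrow> (\<lambda>z. - f z) \<in> sq_integrable \<alpha>"
  using sq_integrable_scale[of f \<alpha> "-1"] by simp

lemma integrable_inner:
  assumes f: "f \<in> sq_integrable \<alpha>" and g: "g \<in> sq_integrable \<alpha>"
  shows "integrable (disk_measure \<alpha>) (\<lambda>z. f z * cnj (g z))"
proof (rule Bochner_Integration.integrable_bound)
  show "integrable (disk_measure \<alpha>) (\<lambda>z. (cmod (f z))\<^sup>2 + (cmod (g z))\<^sup>2)"
    using f g by (intro Bochner_Integration.integrable_add sq_integrable_integrable)
  have "a * b \<le> a\<^sup>2 + b\<^sup>2" if "a \<ge> 0" "b \<ge> 0" for a b :: real
    using zero_le_power2[of "a - b"] mult_nonneg_nonneg[OF that] by (simp add: power2_diff)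
  then show "AE z in disk_measure \<alpha>. norm (f z * cnj (g z)) \<le> norm ((cmod (f z))\<^sup>2 + (cmod (g z))\<^sup>2)"
    by (simp add: norm_mult add_nonneg_nonneg)
  have "(\<lambda>z. cnj (g z)) \<in> borel_measurable (disk_measure \<alpha>)"
    by (rule measurable_compose[OF sq_integrableD[OF g]])
      (intro borel_measurable_continuous_onI continuous_intros)
  then show "(\<lambda>z. f z * cnj (g z)) \<in> borel_measurable (disk_measure \<alpha>)"
    using sq_integrableD[OF f] by (rule borel_measurable_times[rotated])
qed

section \<open>Classes of functions and the operations on them\<close>

lemma equiv_ae_rel: "equiv (sq_integrable \<alpha>) (ae_rel \<alpha>)"
proof (rule equivI)
  show "ae_rel \<alpha> \<subseteq> sq_integrable \<alpha> \<times> sq_integrable \<alpha>" by (auto simp: ae_rel_def)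
  show "refl_on (sq_integrable \<alpha>) (ae_rel \<alpha>)" by (auto simp: ae_rel_def refl_on_def)
  show "sym (ae_rel \<alpha>)" by (auto simp: ae_rel_def sym_def)
  show "trans (ae_rel \<alpha>)"
  proof (rule transI)
    fix f g h assume a: "(f, g) \<in> ae_rel \<alpha>" "(g, h) \<in> ae_rel \<alpha>"
    then have "AE z in disk_measure \<alpha>. f z = g z" "AE z in disk_measure \<alpha>. g z = h z"
      by (auto simp: ae_rel_def)
    then have "AE z in disk_measure \<alpha>. f z = h z" by eventually_elim simp
    with a show "(f, h) \<in> ae_rel \<alpha>" by (auto simp: ae_rel_def)
  qed
qed

lemma mem_L2_class:
  "g \<in> L2_class \<alpha> f \<longleftrightarrow> f \<in> sq_integrable \<alpha> \<and> g \<in> sq_integrable \<alpha> \<and> (AE z in disk_measure \<alpha>. f z = g z)"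
  by (auto simp: L2_class_def ae_rel_def)

lemma L2_class_self: "f \<in> sq_integrable \<alpha> \<Longrightarrow> f \<in> L2_class \<alpha> f"
  by (simp add: mem_L2_class)

lemma L2_class_eq_iff:
  assumes "f \<in> sq_integrable \<alpha>" "g \<in> sq_integrable \<alpha>"
  shows "L2_class \<alpha> f = L2_class \<alpha> g \<longleftrightarrow> (AE z in disk_measure \<alpha>. f z = g z)"
  unfolding L2_class_def using eq_equiv_class_iff[OF equiv_ae_rel assms] assms
  by (auto simp: ae_rel_def)

lemma L2_class_in_vecs [simp]: "f \<in> sq_integrable \<alpha> \<Longrightarrow> L2_class \<alpha> f \<in> vecs (L2_disk \<alpha>)"
  by (simp add: L2_disk_def L2_class_def quotientI)

lemma L2_vecsE:
  assumes "A \<in> vecs (L2_disk \<alpha>)"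
  obtains f where "f \<in> sq_integrable \<alpha>" "A = L2_class \<alpha> f"
  using assms by (auto simp: L2_disk_def L2_class_def elim: quotientE)

text \<open>The operations of \<open>L2_disk\<close> are unions over all representatives;
  independence of the representative collapses such a union to the common value.\<close>

lemma UN_eq_const: "i \<in> I \<Longrightarrow> (\<And>i. i \<in> I \<Longrightarrow> F i = A) \<Longrightarrow> (\<Union>i\<in>I. F i) = A"
  by (rule SUP_eq_const) auto

lemma vadd_L2_class [simp]:
  assumes f: "f \<in> sq_integrable \<alpha>" and g: "g \<in> sq_integrable \<alpha>"
  shows "vadd (L2_disk \<alpha>) (L2_class \<alpha> f) (L2_class \<alpha> g) = L2_class \<alpha> (\<lambda>z. f z + g z)"
proof -
  have eq: "L2_class \<alpha> (\<lambda>z. f' z + g' z) = L2_class \<alpha> (\<lambda>z. f z + g z)"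
    if "f' \<in> L2_class \<alpha> f" "g' \<in> L2_class \<alpha> g" for f' g'
    using that f g by (auto simp: mem_L2_class L2_class_eq_iff)
  have "(\<Union>g'\<in>L2_class \<alpha> g. L2_class \<alpha> (\<lambda>z. f' z + g' z)) = L2_class \<alpha> (\<lambda>z. f z + g z)"
    if "f' \<in> L2_class \<alpha> f" for f'
    by (rule UN_eq_const[OF L2_class_self[OF g]]) (rule eq[OF that])
  then have "(\<Union>f'\<in>L2_class \<alpha> f. \<Union>g'\<in>L2_class \<alpha> g. L2_class \<alpha> (\<lambda>z. f' z + g' z)) =
      L2_class \<alpha> (\<lambda>z. f z + g z)"
    by (rule UN_eq_const[OF L2_class_self[OF f]])
  then show ?thesis by (simp add: L2_disk_def)
qed

lemma vscale_L2_class [simp]: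
  assumes f: "f \<in> sq_integrable \<alpha>"
  shows "vscale (L2_disk \<alpha>) c (L2_class \<alpha> f) = L2_class \<alpha> (\<lambda>z. c * f z)"
proof -
  have "L2_class \<alpha> (\<lambda>z. c * f z) = L2_class \<alpha> (\<lambda>z. c * f' z)" if "f' \<in> L2_class \<alpha> f" for f'
    using that f by (auto simp: mem_L2_class L2_class_eq_iff)
  from this[symmetric] have "(\<Union>f'\<in>L2_class \<alpha> f. L2_class \<alpha> (\<lambda>z. c * f' z)) = L2_class \<alpha> (\<lambda>z. c * f z)"
    by (rule UN_eq_const[OF L2_class_self[OF f]])
  then show ?thesis by (simp add: L2_disk_def)
qed

lemma vzero_L2_class: "vzero (L2_disk \<alpha>) = L2_class \<alpha> (\<lambda>z. 0)"
  by (simp add: L2_disk_def)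

lemma vinner_L2_class [simp]:
  assumes f: "f \<in> sq_integrable \<alpha>" and g: "g \<in> sq_integrable \<alpha>"
  shows "vinner (L2_disk \<alpha>) (L2_class \<alpha> f) (L2_class \<alpha> g) = (LINT z|disk_measure \<alpha>. f z * cnj (g z))"
proof -
  have eq: "(LINT z|disk_measure \<alpha>. f' z * cnj (g' z)) = (LINT z|disk_measure \<alpha>. f z * cnj (g z))"
    if "f' \<in> L2_class \<alpha> f" "g' \<in> L2_class \<alpha> g" for f' g'
  proof (rule integral_cong_AE)
    have "AE z in disk_measure \<alpha>. f z = f' z" "AE z in disk_measure \<alpha>. g z = g' z"
      using that by (auto simp: mem_L2_class)
    then show "AE z in disk_measure \<alpha>. f' z * cnj (g' z) = f z * cnj (g z)"
      by eventually_elim simp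
    have "f' \<in> sq_integrable \<alpha>" "g' \<in> sq_integrable \<alpha>" using that by (auto simp: mem_L2_class)
    with f g show "(\<lambda>z. f' z * cnj (g' z)) \<in> borel_measurable (disk_measure \<alpha>)"
      "(\<lambda>z. f z * cnj (g z)) \<in> borel_measurable (disk_measure \<alpha>)"
      by (blast intro: borel_measurable_integrable integrable_inner)+
  qed
  have "(\<Union>g'\<in>L2_class \<alpha> g. {LINT z|disk_measure \<alpha>. f' z * cnj (g' z)}) =
      {LINT z|disk_measure \<alpha>. f z * cnj (g z)}" if "f' \<in> L2_class \<alpha> f" for f'
    by (rule UN_eq_const[OF L2_class_self[OF g]]) (simp only: eq[OF that])
  then have "(\<Union>f'\<in>L2_class \<alpha> f. \<Union>g'\<in>L2_class \<alpha> g. {LINT z|disk_measure \<alpha>. f' z * cnj (g' z)}) =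
      {LINT z|disk_measure \<alpha>. f z * cnj (g z)}"
    by (rule UN_eq_const[OF L2_class_self[OF f]])
  then show ?thesis by (simp add: L2_disk_def)
qed

lemma vnorm_L2_class_sq:
  assumes f: "f \<in> sq_integrable \<alpha>"
  shows "(vnorm (L2_disk \<alpha>) (L2_class \<alpha> f))\<^sup>2 = (LINT z|disk_measure \<alpha>. (cmod (f z))\<^sup>2)"
proof -
  have "(LINT z|disk_measure \<alpha>. f z * cnj (f z)) = complex_of_real (LINT z|disk_measure \<alpha>. (cmod (f z))\<^sup>2)"
    by (simp flip: complex_norm_square integral_complex_of_real)
  then show ?thesis
    using f by (simp add: vnorm_def integral_nonneg_AE)
qed

lemma vdist_L2_class_sq:
  assumes "f \<in> sq_integrable \<alpha>" "g \<in> sq_integrable \<alpha>"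
  shows "(vdist (L2_disk \<alpha>) (L2_class \<alpha> f) (L2_class \<alpha> g))\<^sup>2 = (LINT z|disk_measure \<alpha>. (cmod (f z - g z))\<^sup>2)"
  using assms vnorm_L2_class_sq[of "\<lambda>z. f z - g z" \<alpha>] by (simp add: vdist_def)

lemma pre_hilbert_L2_disk: "pre_hilbert (L2_disk \<alpha>)"
proof
  show "vzero (L2_disk \<alpha>) \<in> vecs (L2_disk \<alpha>)" by (simp add: vzero_L2_class)
next
  fix A B C :: "(complex \<Rightarrow> complex) set" and c
  assume A: "A \<in> vecs (L2_disk \<alpha>)"
  obtain f where f: "f \<in> sq_integrable \<alpha>" "A = L2_class \<alpha> f" using L2_vecsE[OF A] .
  show "vscale (L2_disk \<alpha>) c A \<in> vecs (L2_disk \<alpha>)" using f by simp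
  show "vinner (L2_disk \<alpha>) (vzero (L2_disk \<alpha>)) A = 0" using f by (simp add: vzero_L2_class)
  have "vinner (L2_disk \<alpha>) A A = complex_of_real (LINT z|disk_measure \<alpha>. (cmod (f z))\<^sup>2)"
    using f by (simp flip: complex_norm_square integral_complex_of_real)
  then show "0 \<le> Re (vinner (L2_disk \<alpha>) A A)" by (simp add: integral_nonneg_AE)
  assume B: "B \<in> vecs (L2_disk \<alpha>)"
  obtain g where g: "g \<in> sq_integrable \<alpha>" "B = L2_class \<alpha> g" using L2_vecsE[OF B] .
  show "vadd (L2_disk \<alpha>) A B \<in> vecs (L2_disk \<alpha>)" using f g by simp
  show "vinner (L2_disk \<alpha>) (vscale (L2_disk \<alpha>) c A) B = c * vinner (L2_disk \<alpha>) A B"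
    using f g by (simp add: mult.assoc)
  have "cnj (LINT z|disk_measure \<alpha>. f z * cnj (g z)) = (LINT z|disk_measure \<alpha>. cnj (f z * cnj (g z)))"
    by (simp only: Bochner_Integration.integral_cnj)
  then show "vinner (L2_disk \<alpha>) B A = cnj (vinner (L2_disk \<alpha>) A B)"
    using f g by (simp add: mult.commute)
  show "A = B" if "vdist (L2_disk \<alpha>) A B = 0"
  proof -
    have "(LINT z|disk_measure \<alpha>. (cmod (f z - g z))\<^sup>2) = 0"
      using vdist_L2_class_sq[of f \<alpha> g] f g that by simp
    then have "AE z in disk_measure \<alpha>. (cmod (f z - g z))\<^sup>2 = 0"
      using f g by (subst (asm) integral_nonneg_eq_0_iff_AE)
        (auto intro!: integrable_norm_diff_sq sq_integrable_integrable)
    then show "A = B" using f g by (simp add: L2_class_eq_iff)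
  qed
  assume C: "C \<in> vecs (L2_disk \<alpha>)"
  obtain h where h: "h \<in> sq_integrable \<alpha>" "C = L2_class \<alpha> h" using L2_vecsE[OF C] .
  show "vinner (L2_disk \<alpha>) (vadd (L2_disk \<alpha>) A B) C =
      vinner (L2_disk \<alpha>) A C + vinner (L2_disk \<alpha>) B C"
    using f g h by (simp add: distrib_right integrable_inner)
qed

theorem hilbert_L2_disk: "hilbert (L2_disk \<alpha>)"
proof (intro hilbert.intro hilbert_axioms.intro pre_hilbert_L2_disk)
  interpret L2: pre_hilbert "L2_disk \<alpha>" by (rule pre_hilbert_L2_disk)
  fix X :: "nat \<Rightarrow> (complex \<Rightarrow> complex) set"
  assume X: "\<And>n. X n \<in> vecs (L2_disk \<alpha>)"
    and C: "\<And>e. e > 0 \<Longrightarrow> \<exists>N. \<forall>m\<ge>N. \<forall>n\<ge>N. vdist (L2_disk \<alpha>) (X m) (X n) < e"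
  have "\<exists>f. f \<in> sq_integrable \<alpha> \<and> X n = L2_class \<alpha> f" for n using L2_vecsE[OF X[of n]] by metis
  then obtain f where f: "\<And>n. f n \<in> sq_integrable \<alpha>" "\<And>n. X n = L2_class \<alpha> (f n)" by metis
  note d = vdist_L2_class_sq[OF f(1) f(1), folded f(2)]
  obtain g where g: "g \<in> borel_measurable (disk_measure \<alpha>)"
    "integrable (disk_measure \<alpha>) (\<lambda>z. (cmod (g z))\<^sup>2)"
    "(\<lambda>n. LINT z|disk_measure \<alpha>. (cmod (f n z - g z))\<^sup>2) \<longlonglongrightarrow> 0"
  proof (rule Riesz_Fischer[of f "disk_measure \<alpha>"])
    fix e :: real assume "e > 0"
    then obtain N where N: "\<forall>m\<ge>N. \<forall>n\<ge>N. vdist (L2_disk \<alpha>) (X m) (X n) < sqrt e"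
      using C[of "sqrt e"] by auto
    have "(vdist (L2_disk \<alpha>) (X m) (X n))\<^sup>2 < e" if "m \<ge> N" "n \<ge> N" for m n
      using N that X \<open>e > 0\<close> power_strict_mono[of "vdist (L2_disk \<alpha>) (X m) (X n)" "sqrt e" 2]
      by simp
    then show "\<exists>N. \<forall>m\<ge>N. \<forall>n\<ge>N. (LINT z|disk_measure \<alpha>. (cmod (f m z - f n z))\<^sup>2) < e"
      unfolding d by blast
  qed (use f sq_integrable_integrable in \<open>auto intro: sq_integrableD\<close>)
  then have gs: "g \<in> sq_integrable \<alpha>" by (simp add: sq_integrable_def)
  have "(\<lambda>n. (vdist (L2_disk \<alpha>) (X n) (L2_class \<alpha> g))\<^sup>2) \<longlonglongrightarrow> 0"
    using g(3) f gs by (simp add: vdist_L2_class_sq)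
  then have "(\<lambda>n. sqrt ((vdist (L2_disk \<alpha>) (X n) (L2_class \<alpha> g))\<^sup>2)) \<longlonglongrightarrow> sqrt 0"
    by (rule tendsto_real_sqrt)
  then have "(\<lambda>n. vdist (L2_disk \<alpha>) (X n) (L2_class \<alpha> g)) \<longlonglongrightarrow> 0"
    using X gs by simp
  with gs show "\<exists>x\<in>vecs (L2_disk \<alpha>). (\<lambda>n. vdist (L2_disk \<alpha>) (X n) x) \<longlonglongrightarrow> 0"
    by (intro bexI[of _ "L2_class \<alpha> g"]) auto
qed

section \<open>Rotation invariance and finiteness of the disk measure\<close>

lemma borel_measurable_Complex_pair [measurable]:
  "(\<lambda>p. Complex (fst p) (snd p)) \<in> borel_measurable (borel \<Otimes>\<^sub>M borel)"
  unfolding borel_prod by (intro borel_measurable_continuous_onI continuous_intros)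

text \<open>Both measures agree on boxes. The product form allows integration line by line, in
  either order.\<close>

lemma lborel_complex: "(lborel :: complex measure) = distr (lborel \<Otimes>\<^sub>M lborel) borel (\<lambda>p. Complex (fst p) (snd p))"
proof (rule lborel_eqI)
  fix l u :: complex
  assume lu: "\<And>b. b \<in> Basis \<Longrightarrow> l \<bullet> b \<le> u \<bullet> b"
  have le: "Re l \<le> Re u" "Im l \<le> Im u"
    using lu[of 1] lu[of \<i>] by (auto simp: Basis_complex_def)
  have pre: "(\<lambda>p. Complex (fst p) (snd p)) -` box l u \<inter> space (lborel \<Otimes>\<^sub>M lborel) = {Re l <..< Re u} \<times> {Im l <..< Im u}"
    by (auto simp: box_def Basis_complex_def space_pair_measure)
  have "emeasure (distr (lborel \<Otimes>\<^sub>M lborel) borel (\<lambda>p. Complex (fst p) (snd p))) (box l u) =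
      emeasure (lborel \<Otimes>\<^sub>M lborel) ({Re l <..< Re u} \<times> {Im l <..< Im u})"
    by (subst emeasure_distr) (auto simp: pre)
  also have "\<dots> = ennreal (Re u - Re l) * ennreal (Im u - Im l)"
    using le by (subst lborel.emeasure_pair_measure_Times) auto
  also have "\<dots> = (\<Prod>b\<in>Basis. (u - l) \<bullet> b)"
    using le by (simp add: Basis_complex_def ennreal_mult)
  finally show "emeasure (distr (lborel \<Otimes>\<^sub>M lborel) borel (\<lambda>p. Complex (fst p) (snd p))) (box l u) =
      (\<Prod>b\<in>Basis. (u - l) \<bullet> b)" .
qed simp

lemma nn_integral_lborel_complex:
  assumes [measurable]: "f \<in> borel_measurable borel"
  shows "(\<integral>\<^sup>+z. f z \<partial>lborel) = (\<integral>\<^sup>+x. \<integral>\<^sup>+y. f (Complex x y) \<partial>lborel \<partial>lborel)"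
    and "(\<integral>\<^sup>+z. f z \<partial>lborel) = (\<integral>\<^sup>+y. \<integral>\<^sup>+x. f (Complex x y) \<partial>lborel \<partial>lborel)"
proof -
  have "(\<integral>\<^sup>+z. f z \<partial>lborel) = (\<integral>\<^sup>+p. f (Complex (fst p) (snd p)) \<partial>(lborel \<Otimes>\<^sub>M lborel))"
    unfolding lborel_complex by (subst nn_integral_distr) auto
  then show "(\<integral>\<^sup>+z. f z \<partial>lborel) = (\<integral>\<^sup>+x. \<integral>\<^sup>+y. f (Complex x y) \<partial>lborel \<partial>lborel)"
    "(\<integral>\<^sup>+z. f z \<partial>lborel) = (\<integral>\<^sup>+y. \<integral>\<^sup>+x. f (Complex x y) \<partial>lborel \<partial>lborel)"
    using lborel.nn_integral_fst[of "\<lambda>p. f (Complex (fst p) (snd p))" lborel]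
      lborel_pair.nn_integral_snd[of "\<lambda>p. f (Complex (fst p) (snd p))"] by simp_all
qed

text \<open>A shear translates every line parallel to its direction, so integrating along these
  lines first reduces it to translation invariance on the real line.\<close>

lemma nn_integral_shear:
  assumes [measurable]: "f \<in> borel_measurable borel"
  shows "(\<integral>\<^sup>+z. f (Complex (Re z + a * Im z) (Im z)) \<partial>lborel) = (\<integral>\<^sup>+z. f z \<partial>lborel)"
    and "(\<integral>\<^sup>+z. f (Complex (Re z) (Im z + a * Re z)) \<partial>lborel) = (\<integral>\<^sup>+z. f z \<partial>lborel)"
proof -
  have [measurable]: "(\<lambda>z. Complex (Re z + a * Im z) (Im z)) \<in> borel_measurable borel"
    "(\<lambda>z. Complex (Re z) (Im z + a * Re z)) \<in> borel_measurable borel"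
    by (intro borel_measurable_continuous_onI continuous_intros)+
  have [measurable]: "(\<lambda>x. f (Complex x y)) \<in> borel_measurable borel" "(\<lambda>y. f (Complex x y)) \<in> borel_measurable borel" for x y
    by (intro measurable_compose[OF _ assms] borel_measurable_continuous_onI continuous_intros)+
  show "(\<integral>\<^sup>+z. f (Complex (Re z + a * Im z) (Im z)) \<partial>lborel) = (\<integral>\<^sup>+z. f z \<partial>lborel)"
    using nn_integral_real_affine[of "\<lambda>x. f (Complex x y)" 1 "a * y" for y]
    by (subst (1 2) nn_integral_lborel_complex(2)) (auto simp: add.commute)
  show "(\<integral>\<^sup>+z. f (Complex (Re z) (Im z + a * Re z)) \<partial>lborel) = (\<integral>\<^sup>+z. f z \<partial>lborel)"
    using nn_integral_real_affine[of "\<lambda>y. f (Complex x y)" 1 "a * x" for x]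
    by (subst (1 2) nn_integral_lborel_complex(1)) (auto simp: add.commute)
qed

text \<open>A rotation by an angle that is not a multiple of \<open>\<pi>\<close> is a product of three shears.\<close>

lemma nn_integral_lborel_rotate:
  fixes \<tau> :: complex
  assumes f: "f \<in> borel_measurable borel" and \<tau>: "cmod \<tau> = 1"
  shows "(\<integral>\<^sup>+z. f (\<tau> * z) \<partial>lborel) = (\<integral>\<^sup>+z. f z \<partial>lborel)"
proof -
  have generic: "(\<integral>\<^sup>+z. f (\<tau> * z) \<partial>lborel) = (\<integral>\<^sup>+z. f z \<partial>lborel)"
    if f [measurable]: "f \<in> borel_measurable borel" and \<tau>: "cmod \<tau> = 1" "Im \<tau> \<noteq> 0" for f and \<tau> :: complex
  proof -
    define c s where "c = Re \<tau>" and "s = Im \<tau>"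
    \<comment> \<open>For tau = cis theta this is -tan (theta/2): two shears by it around one by sin
      theta compose to the rotation.\<close>
    define a where "a = (c - 1) / s"
    have s: "s \<noteq> 0" and cs: "c * c + s * s = 1"
      using \<tau> cmod_power2[of \<tau>] by (auto simp: c_def s_def power2_eq_square)
    have as: "a * s = c - 1" using s by (simp add: a_def)
    have ac: "a * c + a = - s"
    proof -
      have "s * (a * c + a) = (a * s) * (c + 1)" by (simp add: algebra_simps)
      also have "\<dots> = c * c - 1" unfolding as by (simp add: algebra_simps)
      also have "\<dots> = s * - s" using cs by simp
      finally have "s * (a * c + a) = s * - s" .
      then show ?thesis by (rule mult_left_cancel[OF s, THEN iffD1])
    qed
    define X Y where "X z = Complex (Re z + a * Im z) (Im z)" and "Y z = Complex (Re z) (Im z + s * Re z)" for z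
    have [measurable]: "X \<in> borel_measurable borel" "Y \<in> borel_measurable borel"
      unfolding X_def Y_def by (intro borel_measurable_continuous_onI continuous_intros)+
    have eq: "X (Y (X z)) = \<tau> * z" for z
    proof (rule complex_eqI)
      have "Re (X (Y (X z))) = (a * s + 1) * Re z + (a * (a * s + 1) + a) * Im z"
        by (simp add: X_def Y_def algebra_simps)
      then show "Re (X (Y (X z))) = Re (\<tau> * z)"
        using as ac by (simp add: c_def s_def)
      have "Im (X (Y (X z))) = s * Re z + (a * s + 1) * Im z"
        by (simp add: X_def Y_def algebra_simps)
      then show "Im (X (Y (X z))) = Im (\<tau> * z)"
        using as by (simp add: c_def s_def)
    qed
    have "(\<integral>\<^sup>+z. f (\<tau> * z) \<partial>lborel) = (\<integral>\<^sup>+z. f (X (Y (X z))) \<partial>lborel)" by (simp only: eq)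
    also have "\<dots> = (\<integral>\<^sup>+z. f (X (Y z)) \<partial>lborel)"
      by (rule nn_integral_shear(1)[of "\<lambda>z. f (X (Y z))" a, folded X_def]) measurable
    also have "\<dots> = (\<integral>\<^sup>+z. f (X z) \<partial>lborel)"
      by (rule nn_integral_shear(2)[of "\<lambda>z. f (X z)" s, folded Y_def]) measurable
    also have "\<dots> = (\<integral>\<^sup>+z. f z \<partial>lborel)"
      by (rule nn_integral_shear(1)[of f a, folded X_def]) (rule f)
    finally show ?thesis .
  qed
  show ?thesis
  proof (cases "Im \<tau> = 0")
    case False
    then show ?thesis using generic f \<tau> by blast
  next
    case True
    \<comment> \<open>Here tau is 1 or -1. It is written as i times -i tau, two rotations that fall
      under the generic case.\<close>
    then have "Im (- \<i> * \<tau>) \<noteq> 0" using \<tau> by (auto simp: cmod_def)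
    moreover have "(\<lambda>z. f (\<i> * z)) \<in> borel_measurable borel"
      by (intro measurable_compose[OF _ f] borel_measurable_continuous_onI continuous_intros)
    ultimately have "(\<integral>\<^sup>+z. f (\<i> * (- \<i> * \<tau> * z)) \<partial>lborel) = (\<integral>\<^sup>+z. f (\<i> * z) \<partial>lborel)"
      using generic[of "\<lambda>z. f (\<i> * z)" "- \<i> * \<tau>"] \<tau> by (simp add: norm_mult)
    also have "\<dots> = (\<integral>\<^sup>+z. f z \<partial>lborel)"
      using generic[of f \<i>] f by simp
    finally show ?thesis by (simp flip: mult.assoc)
  qed
qed

text \<open>The density on the whole plane. Its values outside the disk are always masked, by an
  indicator or by the restricted measure. It depends on |z| only, which is what rotations
  use.\<close>

definition weight :: "real \<Rightarrow> complex \<Rightarrow> ennreal"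
  where "weight \<alpha> z = ennreal ((\<alpha> + 1) / pi * (1 - (cmod z)\<^sup>2) powr \<alpha>)"

lemma borel_measurable_weight [measurable]: "weight \<alpha> \<in> borel_measurable borel"
  unfolding weight_def by measurable

lemma sets_disk_iff: "A \<in> sets (disk_measure \<alpha>) \<longleftrightarrow> A \<in> sets borel \<and> A \<subseteq> ball 0 1"
  unfolding disk_measure_def sets_density by (subst sets_restrict_space_iff) auto

lemma emeasure_disk_measure:
  assumes "A \<in> sets (disk_measure \<alpha>)"
  shows "emeasure (disk_measure \<alpha>) A = (\<integral>\<^sup>+z. weight \<alpha> z * indicator A z \<partial>lborel)"
proof -
  have A: "A \<in> sets borel" "A \<subseteq> ball 0 1" using assms by (auto simp: sets_disk_iff)
  have "emeasure (disk_measure \<alpha>) A =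
      (\<integral>\<^sup>+z. weight \<alpha> z * indicator A z \<partial>restrict_space lborel (ball 0 1))"
    using assms unfolding disk_measure_def weight_def[symmetric] sets_density
    by (subst emeasure_density) (auto intro!: measurable_restrict_space1)
  also have "\<dots> = (\<integral>\<^sup>+z. weight \<alpha> z * indicator A z * indicator (ball 0 1) z \<partial>lborel)"
    by (subst nn_integral_restrict_space) auto
  also have "\<dots> = (\<integral>\<^sup>+z. weight \<alpha> z * indicator A z \<partial>lborel)"
    using A by (intro nn_integral_cong) (auto simp: indicator_def)
  finally show ?thesis .
qed

lemma measurable_rotate_disk:
  assumes "cmod \<tau> = 1"
  shows "(\<lambda>z. \<tau> * z) \<in> disk_measure \<alpha> \<rightarrow>\<^sub>M disk_measure \<alpha>"
proof (rule measurableI)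
  fix A assume "A \<in> sets (disk_measure \<alpha>)"
  then have A: "A \<in> sets borel" "A \<subseteq> ball 0 1" by (auto simp: sets_disk_iff)
  have "(\<lambda>z. \<tau> * z) \<in> borel_measurable borel"
    by (intro borel_measurable_continuous_onI continuous_intros)
  then have "(\<lambda>z. \<tau> * z) -` A \<in> sets borel"
    using A(1) measurable_sets[of "\<lambda>z. \<tau> * z" borel borel A] by simp
  then show "(\<lambda>z. \<tau> * z) -` A \<inter> space (disk_measure \<alpha>) \<in> sets (disk_measure \<alpha>)"
    by (simp add: sets_disk_iff)
qed (use assms in \<open>auto simp: norm_mult\<close>)

theorem distr_rotate_disk_measure:
  assumes \<tau>: "cmod \<tau> = 1"
  shows "distr (disk_measure \<alpha>) (disk_measure \<alpha>) (\<lambda>z. \<tau> * z) = disk_measure \<alpha>"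
proof (rule measure_eqI)
  fix A assume "A \<in> sets (distr (disk_measure \<alpha>) (disk_measure \<alpha>) (\<lambda>z. \<tau> * z))"
  then have A: "A \<in> sets (disk_measure \<alpha>)" by simp
  then have [measurable]: "A \<in> sets borel" by (simp add: sets_disk_iff)
  let ?B = "(\<lambda>z. \<tau> * z) -` A \<inter> space (disk_measure \<alpha>)"
  have B: "?B \<in> sets (disk_measure \<alpha>)" by (rule measurable_sets[OF measurable_rotate_disk[OF \<tau>] A])
  have "emeasure (distr (disk_measure \<alpha>) (disk_measure \<alpha>) (\<lambda>z. \<tau> * z)) A = emeasure (disk_measure \<alpha>) ?B"
    by (rule emeasure_distr[OF measurable_rotate_disk[OF \<tau>] A])
  also have "\<dots> = (\<integral>\<^sup>+z. weight \<alpha> z * indicator ?B z \<partial>lborel)" by (rule emeasure_disk_measure[OF B])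
  \<comment> \<open>The weight is radial, and z lies in the disk whenever tau z lies in A, so the
    intersection with the disk in \<open>?B\<close> is absorbed.\<close>
  also have "\<dots> = (\<integral>\<^sup>+z. weight \<alpha> (\<tau> * z) * indicator A (\<tau> * z) \<partial>lborel)"
    using A \<tau> by (intro nn_integral_cong)
      (auto simp: weight_def norm_mult indicator_def sets_disk_iff)
  also have "\<dots> = (\<integral>\<^sup>+z. weight \<alpha> z * indicator A z \<partial>lborel)"
    by (rule nn_integral_lborel_rotate[OF _ \<tau>]) measurable
  also have "\<dots> = emeasure (disk_measure \<alpha>) A" by (rule emeasure_disk_measure[OF A, symmetric])
  finally show "emeasure (distr (disk_measure \<alpha>) (disk_measure \<alpha>) (\<lambda>z. \<tau> * z)) A = emeasure (disk_measure \<alpha>) A" .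
qed simp

text \<open>For t in [0,1] the set where 1 - |z|^2 > t is a disk of area pi (1 - t), linear in t, so
  the image measure is uniform. This takes the place of polar coordinates.\<close>

lemma distr_one_minus_norm_sq:
  "distr (restrict_space lborel (ball (0::complex) 1)) borel (\<lambda>z. 1 - (cmod z)\<^sup>2) =
    density lborel (\<lambda>t. ennreal pi * indicator {0..1} t)" (is "?M = ?N")
proof (rule measure_eqI_lessThan)
  have [measurable]: "(\<lambda>z. 1 - (cmod z)\<^sup>2) \<in> borel_measurable (restrict_space lborel (ball 0 1))"
    by (rule measurable_restrict_space1) measurable
  fix t :: real
  \<comment> \<open>The minimum covers t < 0, where the whole unit disk qualifies.\<close>
  let ?r = "sqrt (min 1 (1 - t))"
  have M: "emeasure ?M {t<..} = ennreal (if t < 1 then pi * min 1 (1 - t) else 0)"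
  proof -
    have "emeasure ?M {t<..} = emeasure lborel ({z. t < 1 - (cmod z)\<^sup>2} \<inter> ball 0 1)"
      by (subst emeasure_distr) (auto simp: emeasure_restrict_space space_restrict_space intro!: arg_cong2[of _ _ _ _ emeasure])
    also have "\<dots> = ennreal (if t < 1 then pi * min 1 (1 - t) else 0)"
    proof (cases "t < 1")
      case True
      have "cmod z < 1 \<longleftrightarrow> (cmod z)\<^sup>2 < 1" for z
        using real_sqrt_less_iff[of "(cmod z)\<^sup>2" 1] by simp
      moreover have "cmod z < ?r \<longleftrightarrow> (cmod z)\<^sup>2 < min 1 (1 - t)" for z
        using real_sqrt_less_iff[of "(cmod z)\<^sup>2" "min 1 (1 - t)"] by simp
      ultimately have "{z. t < 1 - (cmod z)\<^sup>2} \<inter> ball 0 1 = ball 0 ?r"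
        by (auto simp: min_def)
      then show ?thesis
        using True by (simp add: emeasure_ball unit_ball_vol_2)
    next
      case False
      then have "\<not> t < 1 - (cmod z)\<^sup>2" for z :: complex
        using zero_le_power2[of "cmod z"] by linarith
      then have "{z. t < 1 - (cmod z)\<^sup>2} \<inter> ball 0 1 = {}" by blast
      with False show ?thesis by simp
    qed
    finally show ?thesis .
  qed
  show "emeasure ?M {t<..} < \<infinity>" unfolding M by simp
  have "emeasure ?N {t<..} = (\<integral>\<^sup>+x. ennreal pi * indicator ({0..1} \<inter> {t<..}) x \<partial>lborel)"
    by (subst emeasure_density) (auto intro!: nn_integral_cong simp: indicator_def)
  also have "\<dots> = ennreal pi * emeasure lborel ({0..1} \<inter> {t<..})"
    by (rule nn_integral_cmult_indicator) auto
  also have "{0..1} \<inter> {t<..} = (if t < 0 then {0..1} else {t<..1})" by auto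
  also have "ennreal pi * emeasure lborel \<dots> = ennreal (if t < 1 then pi * min 1 (1 - t) else 0)"
    by (auto simp: min_def ennreal_mult)
  finally show "emeasure ?M {t<..} = emeasure ?N {t<..}" unfolding M by simp
qed auto

text \<open>The mass reduces to (alpha + 1) times the integral of t^alpha over [0,1], which
  converges for alpha > -1; the product is 1.\<close>

lemma finite_disk_measure:
  assumes "\<alpha> > -1" shows "finite_measure (disk_measure \<alpha>)"
proof
  let ?R = "restrict_space lborel (ball (0::complex) 1)"
  have [measurable]: "(\<lambda>z. 1 - (cmod z)\<^sup>2) \<in> borel_measurable ?R"
    by (rule measurable_restrict_space1) measurable
  have "emeasure (disk_measure \<alpha>) (space (disk_measure \<alpha>)) = (\<integral>\<^sup>+z. weight \<alpha> z \<partial>?R)"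
    unfolding space_disk_measure unfolding disk_measure_def weight_def[symmetric]
    by (subst emeasure_density)
      (auto simp: sets_restrict_space_iff space_restrict_space intro!: measurable_restrict_space1 nn_integral_cong)
  also have "\<dots> = (\<integral>\<^sup>+t. ennreal ((\<alpha> + 1) / pi * t powr \<alpha>) \<partial>distr ?R borel (\<lambda>z. 1 - (cmod z)\<^sup>2))"
    by (subst nn_integral_distr) (auto simp: weight_def[abs_def])
  also have "\<dots> = (\<integral>\<^sup>+t. ennreal pi * indicator {0..1} t * ennreal ((\<alpha> + 1) / pi * t powr \<alpha>) \<partial>lborel)"
    unfolding distr_one_minus_norm_sq by (subst nn_integral_density) auto
  also have "\<dots> = (\<integral>\<^sup>+t. ennreal ((\<alpha> + 1) * t powr \<alpha>) * indicator {0..1} t \<partial>lborel)"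
    using assms by (intro nn_integral_cong) (auto simp: indicator_def ennreal_mult[symmetric])
  also have "\<dots> = ennreal ((\<alpha> + 1) * (1 powr (\<alpha> + 1) / (\<alpha> + 1)))"
    using assms has_integral_mult_right[OF has_integral_powr_from_0[of \<alpha> 1], of "\<alpha> + 1"]
    by (intro nn_integral_has_integral_lebesgue') auto
  also have "\<dots> < \<infinity>" by simp
  finally show "emeasure (disk_measure \<alpha>) (space (disk_measure \<alpha>)) \<noteq> \<infinity>" by simp
qed

section \<open>Totality of the monomials\<close>

text \<open>The measure lives on the open disk, but u is continuous on the compact closed disk and
  hence bounded there.\<close>

lemma integrable_mult_continuous:
  fixes f u :: "complex \<Rightarrow> complex"
  assumes f: "integrable (disk_measure \<alpha>) f" and u: "continuous_on UNIV u"
  shows "integrable (disk_measure \<alpha>) (\<lambda>z. f z * u z)"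
proof -
  have "compact (u ` cball 0 1)"
    by (intro compact_continuous_image continuous_on_subset[OF u]) auto
  then obtain B where "\<forall>w\<in>u ` cball 0 1. cmod w \<le> B"
    using compact_imp_bounded bounded_iff by blast
  then have B: "\<And>z. z \<in> cball 0 1 \<Longrightarrow> cmod (u z) \<le> B" by blast
  have meas: "u \<in> borel_measurable (disk_measure \<alpha>)"
    using borel_measurable_continuous_onI[OF u] measurable_restrict_space1
    by (simp add: measurable_cong_sets[OF sets_disk_measure refl])
  show ?thesis
  proof (rule Bochner_Integration.integrable_bound)
    show "integrable (disk_measure \<alpha>) (\<lambda>z. of_real B * f z)" using f by auto
    show "(\<lambda>z. f z * u z) \<in> borel_measurable (disk_measure \<alpha>)" using f meas by auto
    show "AE z in disk_measure \<alpha>. norm (f z * u z) \<le> norm (of_real B * f z)"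
    proof (rule AE_I2)
      fix z assume "z \<in> space (disk_measure \<alpha>)"
      then have "cmod (u z) \<le> \<bar>B\<bar>" using B[of z] by simp
      then show "norm (f z * u z) \<le> norm (of_real B * f z)"
        using mult_left_mono[of "cmod (u z)" "\<bar>B\<bar>" "cmod (f z)"] by (simp add: norm_mult mult.commute)
    qed
  qed
qed

lemma integral_mult_polynomial_eq_0:
  fixes f :: "complex \<Rightarrow> complex" and g :: "complex \<Rightarrow> real"
  assumes f: "integrable (disk_measure \<alpha>) f"
    and mono: "\<And>p q :: nat. (LINT z|disk_measure \<alpha>. f z * (z ^ p * cnj z ^ q)) = 0"
    and g: "real_polynomial_function g"
  shows "(LINT z|disk_measure \<alpha>. f z * of_real (g z)) = 0"
proof -
  \<comment> \<open>Asking that all moments of f h vanish, and not just its integral, makes V stable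
    under multiplication by z and by its conjugate.\<close>
  define V where "V = {h. continuous_on UNIV h \<and>
    (\<forall>p q :: nat. (LINT z|disk_measure \<alpha>. f z * (h z * (z ^ p * cnj z ^ q))) = 0)}"
  have int: "integrable (disk_measure \<alpha>) (\<lambda>z. f z * (h z * (z ^ p * cnj z ^ q)))"
    if "h \<in> V" for h and p q :: nat
    using that by (intro integrable_mult_continuous f continuous_intros) (auto simp: V_def)
  have V_comb: "(\<lambda>z. c * h z + d * k z) \<in> V" if "h \<in> V" "k \<in> V" for h k c d
  proof -
    have "f z * ((c * h z + d * k z) * (z ^ p * cnj z ^ q)) =
        c * (f z * (h z * (z ^ p * cnj z ^ q))) + d * (f z * (k z * (z ^ p * cnj z ^ q)))" for z and p q :: nat
      by (simp add: algebra_simps)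
    then show ?thesis
      using that int[OF that(1)] int[OF that(2)] by (auto simp: V_def intro!: continuous_intros)
  qed
  have V_z: "(\<lambda>z. z * h z) \<in> V" and V_cnj: "(\<lambda>z. cnj z * h z) \<in> V" if "h \<in> V" for h
  proof -
    have "f z * (z * h z * (z ^ p * cnj z ^ q)) = f z * (h z * (z ^ Suc p * cnj z ^ q))"
      "f z * (cnj z * h z * (z ^ p * cnj z ^ q)) = f z * (h z * (z ^ p * cnj z ^ Suc q))" for z and p q :: nat
      by (simp_all add: algebra_simps)
    then show "(\<lambda>z. z * h z) \<in> V" "(\<lambda>z. cnj z * h z) \<in> V"
      using that by (auto simp only: V_def mem_Collect_eq intro!: continuous_intros)
  qed
  \<comment> \<open>The induction claim is that multiplication by g maps V into V; in this form the
    product case is a composition.\<close>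
  have V_mult: "(\<lambda>z. of_real (g z) * h z) \<in> V" if "h \<in> V" for h
    using g that
  proof (induction arbitrary: h)
    case (linear L)
    \<comment> \<open>A real-linear functional has the form a z + b cnj z; these coefficients come
      from its values at 1 and i.\<close>
    define a b where "a = (of_real (L 1) - \<i> * of_real (L \<i>)) / 2" and "b = (of_real (L 1) + \<i> * of_real (L \<i>)) / 2"
    have "of_real (L z) = a * z + b * cnj z" for z
    proof -
      interpret bounded_linear L by (rule linear(1))
      have "L z = L (Re z *\<^sub>R 1 + Im z *\<^sub>R \<i>)"
        by (rule arg_cong[of _ _ L]) (simp add: complex_eq_iff)
      also have "\<dots> = Re z * L 1 + Im z * L \<i>" by (simp only: add scaleR real_scaleR_def)
      finally have L: "L z = Re z * L 1 + Im z * L \<i>" .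
      show ?thesis unfolding L by (simp add: a_def b_def complex_eq_iff field_simps)
    qed
    then have "(\<lambda>z. of_real (L z) * h z) = (\<lambda>z. a * (z * h z) + b * (cnj z * h z))"
      by (simp add: fun_eq_iff algebra_simps)
    then show ?case using V_comb[OF V_z V_cnj] linear(2) by simp
  next
    case (const c)
    then show ?case using V_comb[of h h "of_real c" 0] by simp
  next
    case (add g k)
    then show ?case using V_comb[OF add(3,4), of h h 1 1] by (simp add: algebra_simps)
  next
    case (mult g k)
    from mult(3)[OF mult(4)[OF mult(5)]] show ?case by (simp add: mult.assoc)
  qed
  have "(\<lambda>z. 1) \<in> V" using mono by (simp add: V_def)
  from V_mult[OF this] show ?thesis
    unfolding V_def mem_Collect_eq by (metis (no_types, lifting) Bochner_Integration.integral_cong mult.right_neutral power_0)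
qed

text \<open>Stone-Weierstrass on the closed disk: polynomials contribute 0, and a uniform error
  costs at most that error times the L1 norm K of f.\<close>

lemma integral_mult_continuous_eq_0:
  fixes f :: "complex \<Rightarrow> complex" and u :: "complex \<Rightarrow> real"
  assumes f: "integrable (disk_measure \<alpha>) f"
    and mono: "\<And>p q :: nat. (LINT z|disk_measure \<alpha>. f z * (z ^ p * cnj z ^ q)) = 0"
    and u: "continuous_on UNIV u"
  shows "(LINT z|disk_measure \<alpha>. f z * of_real (u z)) = 0"
proof -
  let ?I = "LINT z|disk_measure \<alpha>. f z * of_real (u z)"
  define K where "K = (LINT z|disk_measure \<alpha>. cmod (f z))"
  have K: "K \<ge> 0" unfolding K_def by (intro integral_nonneg_AE) simp
  have "cmod ?I \<le> e" if "e > 0" for e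
  proof -
    \<comment> \<open>K may be 0, hence K + 1; the total error is e K/(K + 1) <= e.\<close>
    have "e / (K + 1) > 0" using that K by simp
    then obtain g where g: "real_polynomial_function g" "\<And>z. z \<in> cball 0 1 \<Longrightarrow> \<bar>u z - g z\<bar> < e / (K + 1)"
      using Stone_Weierstrass_real_polynomial_function[of "cball 0 1" u "e / (K + 1)"]
        continuous_on_subset[OF u] by (metis compact_cball subset_UNIV)
    have gc: "continuous_on UNIV g"
      using g(1) by (simp add: continuous_on_polymonial_function real_polynomial_function_eq)
    have iu: "integrable (disk_measure \<alpha>) (\<lambda>z. f z * of_real (u z))"
      and ig: "integrable (disk_measure \<alpha>) (\<lambda>z. f z * of_real (g z))"
      using u gc by (auto intro!: integrable_mult_continuous f continuous_intros)
    have "?I = (LINT z|disk_measure \<alpha>. f z * of_real (u z) - f z * of_real (g z))"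
      using iu ig integral_mult_polynomial_eq_0[OF f mono g(1)] by simp
    also have "cmod \<dots> \<le> (LINT z|disk_measure \<alpha>. cmod (f z * of_real (u z) - f z * of_real (g z)))"
      by (rule integral_norm_bound)
    also have "\<dots> \<le> (LINT z|disk_measure \<alpha>. e / (K + 1) * cmod (f z))"
    proof (rule integral_mono)
      fix z assume "z \<in> space (disk_measure \<alpha>)"
      then have "\<bar>u z - g z\<bar> \<le> e / (K + 1)" using g(2)[of z] by simp
      then have "cmod (f z) * \<bar>u z - g z\<bar> \<le> cmod (f z) * (e / (K + 1))"
        by (rule mult_left_mono) simp
      moreover have "cmod (f z * of_real (u z) - f z * of_real (g z)) = cmod (f z) * \<bar>u z - g z\<bar>"
        by (simp add: norm_mult flip: right_diff_distrib of_real_diff)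
      ultimately show "cmod (f z * of_real (u z) - f z * of_real (g z)) \<le> e / (K + 1) * cmod (f z)"
        by (simp only: mult.commute)
    qed (use iu ig f in auto)
    also have "\<dots> = e * (K / (K + 1))" by (simp add: K_def)
    also have "\<dots> \<le> e" using that K by (intro mult_left_le) auto
    finally show ?thesis .
  qed
  then have "cmod ?I \<le> 0"
    by - (rule field_le_epsilon, simp)
  then show ?thesis by simp
qed

lemma integral_closed_eq_0:
  fixes f :: "complex \<Rightarrow> complex"
  assumes f: "integrable (disk_measure \<alpha>) f"
    and mono: "\<And>p q :: nat. (LINT z|disk_measure \<alpha>. f z * (z ^ p * cnj z ^ q)) = 0"
    and C: "closed C"
  shows "(LINT z|disk_measure \<alpha>. indicator C z *\<^sub>R f z) = 0"
\<comment> \<open>By convention \<open>infdist\<close> to the empty set is 0, which would make the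
  tent functions below constantly 1.\<close>
proof (cases "C = {}")
  case False
  \<comment> \<open>Tent functions: 1 on C and 0 beyond distance 1/n. Since C is closed, they
    converge pointwise to its indicator.\<close>
  define u where "u n z = max 0 (1 - real n * infdist z C)" for n z
  have uc: "continuous_on UNIV (u n)" for n unfolding u_def by (intro continuous_intros)
  have "(\<lambda>n. LINT z|disk_measure \<alpha>. f z * of_real (u n z)) \<longlonglongrightarrow> (LINT z|disk_measure \<alpha>. indicator C z *\<^sub>R f z)"
  proof (rule integral_dominated_convergence)
    show "integrable (disk_measure \<alpha>) (\<lambda>z. cmod (f z))" using f by simp
    have "C \<in> sets borel" using C by simp
    \<comment> \<open>C may leave the disk, so measurability is shown for its trace on the disk and
      transferred by agreement there.\<close>
    then have "C \<inter> ball 0 1 \<in> sets (disk_measure \<alpha>)" by (simp add: sets_disk_iff)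
    then have "integrable (disk_measure \<alpha>) (\<lambda>z. indicator (C \<inter> ball 0 1) z *\<^sub>R f z)"
      using f by (rule integrable_mult_indicator)
    then have "(\<lambda>z. indicator (C \<inter> ball 0 1) z *\<^sub>R f z) \<in> borel_measurable (disk_measure \<alpha>)"
      by (rule borel_measurable_integrable)
    then show "(\<lambda>z. indicator C z *\<^sub>R f z) \<in> borel_measurable (disk_measure \<alpha>)"
      by (rule measurable_cong[THEN iffD1, rotated]) (auto simp: indicator_def)
    show "(\<lambda>z. f z * of_real (u n z)) \<in> borel_measurable (disk_measure \<alpha>)" for n
      using uc by (intro borel_measurable_integrable integrable_mult_continuous f continuous_intros)
    have "norm (f z * of_real (u n z)) \<le> cmod (f z)" for n z
      using infdist_nonneg[of z C] by (auto simp: norm_mult u_def intro!: mult_left_le)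
    then show "AE z in disk_measure \<alpha>. norm (f z * of_real (u n z)) \<le> cmod (f z)" for n by simp
    have "(\<lambda>n. f z * of_real (u n z)) \<longlonglongrightarrow> indicator C z *\<^sub>R f z" for z
    proof (cases "z \<in> C")
      case True
      then show ?thesis by (simp add: u_def)
    next
      case nz: False
      then have "infdist z C > 0"
        using in_closed_iff_infdist_zero[OF C False] infdist_nonneg[of z C] by (auto simp: less_le)
      then obtain N where N: "1 < real N * infdist z C" by (rule ex_less_of_nat_mult[THEN exE])
      have "u n z = 0" if "n \<ge> N" for n
        using that N mult_right_mono[of "real N" "real n" "infdist z C"] infdist_nonneg[of z C]
        by (simp add: u_def max_def)
      then show ?thesis
        using nz by (intro tendsto_eventually eventually_sequentiallyI[of N]) auto
    qed
    then show "AE z in disk_measure \<alpha>. (\<lambda>n. f z * of_real (u n z)) \<longlonglongrightarrow> indicator C z *\<^sub>R f z" by simp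
  qed
  then show ?thesis
    using integral_mult_continuous_eq_0[OF f mono uc] by (simp add: LIMSEQ_const_iff)
qed simp

text \<open>Dynkin argument from the closed sets, an intersection-stable generator of the Borel
  sets. Cutting with the ball inside \<open>?J\<close> lets it run over Borel sets of the
  plane.\<close>

lemma set_integral_eq_0:
  fixes f :: "complex \<Rightarrow> complex"
  assumes f: "integrable (disk_measure \<alpha>) f"
    and mono: "\<And>p q :: nat. (LINT z|disk_measure \<alpha>. f z * (z ^ p * cnj z ^ q)) = 0"
    and A: "A \<in> sets (disk_measure \<alpha>)"
  shows "(LINT z:A|disk_measure \<alpha>. f z) = 0"
proof -
  let ?J = "\<lambda>B. LINT z:(B \<inter> ball 0 1)|disk_measure \<alpha>. f z"
  have sets: "B \<inter> ball 0 1 \<in> sets (disk_measure \<alpha>)" if "B \<in> sets borel" for B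
    using that by (simp add: sets_disk_iff)
  have "?J B = 0" if "B \<in> sigma_sets UNIV (Collect closed)" for B
  proof -
    have "Int_stable (Collect closed :: complex set set)" by (auto simp: Int_stable_def)
    from this subset_UNIV[of "Collect closed", folded Pow_UNIV] that show ?thesis
    proof (induction rule: sigma_sets_induct_disjoint)
      case (basic B)
      have "?J B = (LINT z|disk_measure \<alpha>. indicator B z *\<^sub>R f z)"
        unfolding set_lebesgue_integral_def
        by (rule Bochner_Integration.integral_cong) (auto simp: indicator_def)
      then show ?case using integral_closed_eq_0[OF f mono] basic by simp
    next
      case (compl B)
      then have B: "B \<in> sets borel" by (simp add: borel_eq_closed)
      \<comment> \<open>The complement needs the integral over the whole disk, which is the moment
        with p = q = 0.\<close>
      have "?J (UNIV - B) = (LINT z|disk_measure \<alpha>. f z - indicator (B \<inter> ball 0 1) z *\<^sub>R f z)"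
        unfolding set_lebesgue_integral_def
        by (rule Bochner_Integration.integral_cong) (auto simp: indicator_def)
      also have "\<dots> = (LINT z|disk_measure \<alpha>. f z) - ?J B"
        unfolding set_lebesgue_integral_def
        by (intro Bochner_Integration.integral_diff f integrable_mult_indicator sets B)
      also have "\<dots> = 0" using compl mono[of 0 0] by simp
      finally show ?case .
    next
      case (union D)
      then have D: "D i \<in> sets borel" for i by (auto simp: borel_eq_closed)
      have "?J (\<Union>i. D i) = (LINT z:(\<Union>i. D i \<inter> ball 0 1)|disk_measure \<alpha>. f z)"
        by (simp add: Int_UN_distrib2 Int_commute)
      also have "\<dots> = (\<Sum>i. ?J (D i))"
      proof (rule lebesgue_integral_countable_add)
        show "D i \<inter> ball 0 1 \<in> sets (disk_measure \<alpha>)" for i using sets[OF D] .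
        then have "(\<Union>i. D i \<inter> ball 0 1) \<in> sets (disk_measure \<alpha>)"
          by (intro sets.countable_nat_UN) blast
        then show "set_integrable (disk_measure \<alpha>) (\<Union>i. D i \<inter> ball 0 1) f"
          unfolding set_integrable_def using f by (rule integrable_mult_indicator)
        show "(D i \<inter> ball 0 1) \<inter> (D j \<inter> ball 0 1) = {}" if "i \<noteq> j" for i j
          using union that by (auto simp: disjoint_family_on_def)
      qed
      also have "\<dots> = 0" using union by simp
      finally show ?case .
    qed (auto simp: set_lebesgue_integral_def)
  qed
  moreover have "A \<in> sigma_sets UNIV (Collect closed)" "A \<inter> ball 0 1 = A"
    using A by (auto simp: sets_disk_iff borel_eq_closed)
  ultimately show ?thesis by metis
qed

text \<open>All set integrals of f vanish; uniqueness of real densities applies to the real and the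
  imaginary part.\<close>

theorem AE_eq_0_of_moments:
  fixes f :: "complex \<Rightarrow> complex"
  assumes f: "integrable (disk_measure \<alpha>) f"
    and mono: "\<And>p q :: nat. (LINT z|disk_measure \<alpha>. f z * (z ^ p * cnj z ^ q)) = 0"
  shows "AE z in disk_measure \<alpha>. f z = 0"
proof -
  have s: "(LINT z|disk_measure \<alpha>. indicator A z *\<^sub>R f z) = 0"
    "integrable (disk_measure \<alpha>) (\<lambda>z. indicator A z *\<^sub>R f z)" if "A \<in> sets (disk_measure \<alpha>)" for A
    using set_integral_eq_0[OF f mono that] integrable_mult_indicator[OF that f]
    by (simp_all add: set_lebesgue_integral_def)
  have "AE z in disk_measure \<alpha>. Re (f z) = 0"
  proof (rule density_unique_real)
    fix A assume "A \<in> sets (disk_measure \<alpha>)"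
    from arg_cong[OF s(1)[OF this], of Re] s(2)[OF this]
    show "(LINT z:A|disk_measure \<alpha>. Re (f z)) = (LINT z:A|disk_measure \<alpha>. 0)"
      by (simp add: set_lebesgue_integral_def flip: integral_Re)
  qed (use f in auto)
  moreover have "AE z in disk_measure \<alpha>. Im (f z) = 0"
  proof (rule density_unique_real)
    fix A assume "A \<in> sets (disk_measure \<alpha>)"
    from arg_cong[OF s(1)[OF this], of Im] s(2)[OF this]
    show "(LINT z:A|disk_measure \<alpha>. Im (f z)) = (LINT z:A|disk_measure \<alpha>. 0)"
      by (simp add: set_lebesgue_integral_def flip: integral_Im)
  qed (use f in auto)
  ultimately show ?thesis by eventually_elim (simp add: complex_eq_iff)
qed

section \<open>Rotations and their eigenspaces\<close>

interpretation L2: hilbert "L2_disk \<alpha>" for \<alpha>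
  by (rule hilbert_L2_disk)

lemma sq_integrable_monomial:
  assumes "\<alpha> > -1" shows "(\<lambda>z. z ^ p * cnj z ^ q) \<in> sq_integrable \<alpha>"
proof -
  interpret finite_measure "disk_measure \<alpha>" by (rule finite_disk_measure[OF assms])
  have "(\<lambda>z. z ^ p * cnj z ^ q) \<in> borel_measurable borel"
    by (intro borel_measurable_continuous_onI continuous_intros)
  then have m: "(\<lambda>z. z ^ p * cnj z ^ q) \<in> borel_measurable (disk_measure \<alpha>)"
    using measurable_restrict_space1 by (simp add: measurable_cong_sets[OF sets_disk_measure refl])
  moreover have "integrable (disk_measure \<alpha>) (\<lambda>z. (cmod (z ^ p * cnj z ^ q))\<^sup>2)"
  proof (rule integrable_const_bound[of _ 1])
    show "AE z in disk_measure \<alpha>. norm ((cmod (z ^ p * cnj z ^ q))\<^sup>2) \<le> 1"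
    proof (rule AE_I2)
      fix z :: complex assume "z \<in> space (disk_measure \<alpha>)"
      then have "cmod (z ^ p * cnj z ^ q) \<le> 1"
        by (simp add: norm_mult norm_power mult_le_one power_le_one)
      then show "norm ((cmod (z ^ p * cnj z ^ q))\<^sup>2) \<le> 1" by (simp add: power_le_one)
    qed
  qed (use m in measurable)
  ultimately show ?thesis by (simp add: sq_integrable_def)
qed

lemma sq_integrable_rotate:
  assumes f: "f \<in> sq_integrable \<alpha>" and \<tau>: "cmod \<tau> = 1"
  shows "(\<lambda>z. f (\<tau> * z)) \<in> sq_integrable \<alpha>"
proof -
  note R = measurable_rotate_disk[OF \<tau>]
  have fm: "f \<in> borel_measurable (disk_measure \<alpha>)" by (rule sq_integrableD[OF f])
  have "(\<lambda>z. (cmod (f z))\<^sup>2) \<in> borel_measurable (disk_measure \<alpha>)" using fm by measurable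
  then have "integrable (disk_measure \<alpha>) (\<lambda>z. (cmod (f (\<tau> * z)))\<^sup>2)"
    using integrable_distr_eq[OF R, of "\<lambda>z. (cmod (f z))\<^sup>2" \<alpha>] sq_integrable_integrable[OF f]
    by (simp add: distr_rotate_disk_measure[OF \<tau>])
  then show ?thesis using measurable_compose[OF R fm] by (simp add: sq_integrable_def)
qed

text \<open>Rotations preserve the measure and therefore null sets, so the rotated class does not
  depend on the representative.\<close>

lemma rotation_L2_class:
  assumes \<tau>: "cmod \<tau> = 1" and f: "f \<in> sq_integrable \<alpha>"
  shows "rotation \<alpha> \<tau> (L2_class \<alpha> f) = L2_class \<alpha> (\<lambda>z. f (inverse \<tau> * z))"
proof -
  have \<sigma>: "cmod (inverse \<tau>) = 1" using \<tau> by (simp add: norm_inverse)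
  have "L2_class \<alpha> (\<lambda>z. f (inverse \<tau> * z)) = L2_class \<alpha> (\<lambda>z. g (inverse \<tau> * z))"
    if g: "g \<in> L2_class \<alpha> f" for g
  proof -
    have "AE z in distr (disk_measure \<alpha>) (disk_measure \<alpha>) (\<lambda>z. inverse \<tau> * z). f z = g z"
      using g by (simp only: distr_rotate_disk_measure[OF \<sigma>] mem_L2_class)
    then have "AE z in disk_measure \<alpha>. f (inverse \<tau> * z) = g (inverse \<tau> * z)"
      by (rule AE_distrD[OF measurable_rotate_disk[OF \<sigma>]])
    then show ?thesis
      using g f \<sigma> by (simp add: L2_class_eq_iff mem_L2_class sq_integrable_rotate)
  qed
  from this[symmetric] have "(\<Union>g\<in>L2_class \<alpha> f. L2_class \<alpha> (\<lambda>z. g (inverse \<tau> * z))) =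
      L2_class \<alpha> (\<lambda>z. f (inverse \<tau> * z))"
    by (rule UN_eq_const[OF L2_class_self[OF f]])
  then show ?thesis using f by (simp add: rotation_def)
qed

lemma rotation_closed [simp]:
  assumes "cmod \<tau> = 1" "A \<in> vecs (L2_disk \<alpha>)" shows "rotation \<alpha> \<tau> A \<in> vecs (L2_disk \<alpha>)"
proof -
  obtain f where "f \<in> sq_integrable \<alpha>" "A = L2_class \<alpha> f" using L2_vecsE[OF assms(2)] .
  then show ?thesis
    using assms(1) by (simp add: rotation_L2_class sq_integrable_rotate norm_inverse)
qed

lemma inner_rotation:
  assumes \<tau>: "cmod \<tau> = 1" and A: "A \<in> vecs (L2_disk \<alpha>)" and B: "B \<in> vecs (L2_disk \<alpha>)"
  shows "vinner (L2_disk \<alpha>) (rotation \<alpha> \<tau> A) (rotation \<alpha> \<tau> B) = vinner (L2_disk \<alpha>) A B"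
proof -
  obtain f where f: "f \<in> sq_integrable \<alpha>" "A = L2_class \<alpha> f" using L2_vecsE[OF A] .
  obtain g where g: "g \<in> sq_integrable \<alpha>" "B = L2_class \<alpha> g" using L2_vecsE[OF B] .
  have \<sigma>: "cmod (inverse \<tau>) = 1" using \<tau> by (simp add: norm_inverse)
  have "(LINT z|disk_measure \<alpha>. f (inverse \<tau> * z) * cnj (g (inverse \<tau> * z))) =
      (LINT z|distr (disk_measure \<alpha>) (disk_measure \<alpha>) (\<lambda>z. inverse \<tau> * z). f z * cnj (g z))"
    by (rule integral_distr[OF measurable_rotate_disk[OF \<sigma>], symmetric])
      (rule borel_measurable_integrable[OF integrable_inner[OF f(1) g(1)]])
  then show ?thesis
    using f g \<tau> \<sigma> by (simp add: rotation_L2_class sq_integrable_rotate distr_rotate_disk_measure)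
qed

lemma rotation_bounded:
  assumes \<tau>: "cmod \<tau> = 1" shows "rotation \<alpha> \<tau> \<in> bounded_ops (L2_disk \<alpha>)"
proof (rule L2.bounded_opsI[of _ _ 1])
  fix A B :: "(complex \<Rightarrow> complex) set" and c
  assume A: "A \<in> vecs (L2_disk \<alpha>)"
  obtain f where f: "f \<in> sq_integrable \<alpha>" "A = L2_class \<alpha> f" using L2_vecsE[OF A] .
  have \<sigma>: "cmod (inverse \<tau>) = 1" using \<tau> by (simp add: norm_inverse)
  note simps = rotation_L2_class[OF \<tau>] sq_integrable_rotate[OF _ \<sigma>]
  show "rotation \<alpha> \<tau> A \<in> vecs (L2_disk \<alpha>)" using \<tau> A by simp
  show "rotation \<alpha> \<tau> (vscale (L2_disk \<alpha>) c A) = vscale (L2_disk \<alpha>) c (rotation \<alpha> \<tau> A)"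
    using f by (simp add: simps)
  show "vnorm (L2_disk \<alpha>) (rotation \<alpha> \<tau> A) \<le> 1 * vnorm (L2_disk \<alpha>) A"
    using inner_rotation[OF \<tau> A A] by (simp add: vnorm_def)
  assume B: "B \<in> vecs (L2_disk \<alpha>)"
  obtain g where g: "g \<in> sq_integrable \<alpha>" "B = L2_class \<alpha> g" using L2_vecsE[OF B] .
  show "rotation \<alpha> \<tau> (vadd (L2_disk \<alpha>) A B) = vadd (L2_disk \<alpha>) (rotation \<alpha> \<tau> A) (rotation \<alpha> \<tau> B)"
    using f g by (simp add: simps)
qed (simp add: rotation_def)

text \<open>The inverse comes from the action f (inverse tau z), under which z^p cnj z^q gains the
  factor (inverse tau)^(p-q).\<close>

definition eigenspace :: "real \<Rightarrow> int \<Rightarrow> (complex \<Rightarrow> complex) set set"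
  where "eigenspace \<alpha> \<xi> = {A \<in> vecs (L2_disk \<alpha>). \<forall>\<tau>. cmod \<tau> = 1 \<longrightarrow>
    rotation \<alpha> \<tau> A = vscale (L2_disk \<alpha>) (inverse \<tau> powi \<xi>) A}"

text \<open>Closedness: rotation and multiplication by a unimodular scalar are isometries, so the
  defect of A in the eigenvalue equation is at most twice its distance to any eigenvector B.\<close>

lemma eigenspace_closed_subspace:
  "lin_subspace (L2_disk \<alpha>) (eigenspace \<alpha> \<xi>)"
  "norm_closure (L2_disk \<alpha>) (eigenspace \<alpha> \<xi>) \<subseteq> eigenspace \<alpha> \<xi>"
proof -
  let ?H = "L2_disk \<alpha>"
  note rot_add = L2.bounded_ops_add[OF rotation_bounded]
    and rot_scale = L2.bounded_ops_scale[OF rotation_bounded]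
  show "lin_subspace ?H (eigenspace \<alpha> \<xi>)"
    unfolding lin_subspace_def
  proof (intro conjI ballI allI)
    show "eigenspace \<alpha> \<xi> \<subseteq> vecs ?H" by (auto simp: eigenspace_def)
    show "vzero ?H \<in> eigenspace \<alpha> \<xi>"
      by (auto simp: eigenspace_def vzero_L2_class rotation_L2_class)
    fix A assume A: "A \<in> eigenspace \<alpha> \<xi>"
    show "vadd ?H A B \<in> eigenspace \<alpha> \<xi>" if B: "B \<in> eigenspace \<alpha> \<xi>" for B
    proof -
      have "rotation \<alpha> \<tau> (vadd ?H A B) = vscale ?H (inverse \<tau> powi \<xi>) (vadd ?H A B)" if "cmod \<tau> = 1" for \<tau>
        by (rule L2.vec_eqI[where \<alpha> = \<alpha>]) (use A B that in \<open>auto simp: eigenspace_def rot_add distrib_left\<close>)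
      then show ?thesis using A B by (simp add: eigenspace_def)
    qed
    show "vscale ?H c A \<in> eigenspace \<alpha> \<xi>" for c
    proof -
      have "rotation \<alpha> \<tau> (vscale ?H c A) = vscale ?H (inverse \<tau> powi \<xi>) (vscale ?H c A)" if "cmod \<tau> = 1" for \<tau>
        by (rule L2.vec_eqI[where \<alpha> = \<alpha>]) (use A that in \<open>auto simp: eigenspace_def rot_scale\<close>)
      then show ?thesis using A by (simp add: eigenspace_def)
    qed
  qed
  show "norm_closure ?H (eigenspace \<alpha> \<xi>) \<subseteq> eigenspace \<alpha> \<xi>"
  proof
    fix A assume A: "A \<in> norm_closure ?H (eigenspace \<alpha> \<xi>)"
    then have AV: "A \<in> vecs ?H" by (simp add: norm_closure_def)
    have "rotation \<alpha> \<tau> A = vscale ?H (inverse \<tau> powi \<xi>) A" if \<tau>: "cmod \<tau> = 1" for \<tau>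
    proof (rule L2.vdist_eq_0D)
      let ?R = "rotation \<alpha> \<tau>" and ?s = "\<lambda>A. vscale ?H (inverse \<tau> powi \<xi>) A"
      have c: "cmod (inverse \<tau> powi \<xi>) = 1" using \<tau> by (simp add: norm_power_int norm_inverse)
      have "vdist ?H (?R A) (?s A) \<le> 0 + e" if "e > 0" for e
      proof -
        obtain B where B: "B \<in> eigenspace \<alpha> \<xi>" "vdist ?H A B < e/2"
          using L2.norm_closureE[OF A half_gt_zero[OF \<open>e > 0\<close>]] by blast
        then have BV: "B \<in> vecs ?H" and RB: "?R B = ?s B" using \<tau> by (auto simp: eigenspace_def)
        let ?d = "vadd ?H A (vscale ?H (-1) B)"
        have "vadd ?H (?R A) (vscale ?H (-1) (?R B)) = ?R ?d"
          using \<tau> AV BV by (simp add: rot_add rot_scale)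
        then have 1: "vdist ?H (?R A) (?R B) = vdist ?H A B"
          using inner_rotation[OF \<tau>, of ?d \<alpha> ?d] AV BV by (simp add: vdist_def vnorm_def)
        have "vadd ?H (?s B) (vscale ?H (-1) (?s A)) = ?s (vadd ?H B (vscale ?H (-1) A))"
          by (rule L2.vec_eqI[where \<alpha> = \<alpha>]) (use AV BV in \<open>auto simp: algebra_simps\<close>)
        then have 2: "vdist ?H (?s B) (?s A) = vdist ?H B A"
          using AV BV c by (simp add: vdist_def L2.vnorm_scale)
        have "vdist ?H (?R A) (?s A) \<le> vdist ?H (?R A) (?R B) + vdist ?H (?s B) (?s A)"
          using L2.vdist_triangle[of "?R A" \<alpha> "?R B" "?s A"] \<tau> AV BV RB by simp
        then show ?thesis
          unfolding 1 2 using B(2) L2.vdist_commute[OF AV BV] by simp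
      qed
      then have "vdist ?H (?R A) (?s A) \<le> 0" by (rule field_le_epsilon)
      then show "vdist ?H (?R A) (?s A) = 0"
        by (rule order_antisym[OF _ L2.vdist_nonneg]) (use AV \<tau> in auto)
    qed (use AV \<tau> in auto)
    with AV show "A \<in> eigenspace \<alpha> \<xi>" by (simp add: eigenspace_def)
  qed
qed

lemma cnj_eq_inverse: "cmod z = 1 \<Longrightarrow> cnj z = inverse z"
  using complex_norm_square[of z] by (intro inverse_unique[symmetric]) simp

lemma eigenspace_orthogonal:
  assumes "\<xi> \<noteq> \<eta>" and A: "A \<in> eigenspace \<alpha> \<xi>" and B: "B \<in> eigenspace \<alpha> \<eta>"
  shows "vinner (L2_disk \<alpha>) A B = 0"
proof -
  \<comment> \<open>Chosen with sigma^(xi - eta) = -1, so that unitarity of the rotation equates the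
    inner product with its negative.\<close>
  define \<sigma> where "\<sigma> = cis (pi / of_int (\<xi> - \<eta>))"
  have \<sigma>: "cmod \<sigma> = 1" "\<sigma> \<noteq> 0" by (simp_all add: \<sigma>_def)
  have AV: "A \<in> vecs (L2_disk \<alpha>)" and BV: "B \<in> vecs (L2_disk \<alpha>)"
    using A B by (auto simp: eigenspace_def)
  have "\<sigma> powi (\<xi> - \<eta>) = -1"
    using \<open>\<xi> \<noteq> \<eta>\<close> by (simp add: \<sigma>_def cis_power_int)
  moreover have "cnj (\<sigma> powi \<eta>) = inverse (\<sigma> powi \<eta>)"
    using \<sigma> by (intro cnj_eq_inverse) (simp add: norm_power_int)
  ultimately have m: "\<sigma> powi \<xi> * cnj (\<sigma> powi \<eta>) = -1"
    using \<sigma> by (simp add: power_int_diff divide_inverse)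
  \<comment> \<open>Rotating by the inverse of sigma makes the eigenvalues powers of sigma
    itself.\<close>
  have "vinner (L2_disk \<alpha>) A B = vinner (L2_disk \<alpha>) (rotation \<alpha> (inverse \<sigma>) A) (rotation \<alpha> (inverse \<sigma>) B)"
    using \<sigma> AV BV by (simp add: inner_rotation norm_inverse)
  also have "\<dots> = \<sigma> powi \<xi> * cnj (\<sigma> powi \<eta>) * vinner (L2_disk \<alpha>) A B"
    using A B AV BV \<sigma> by (simp add: eigenspace_def norm_inverse)
  finally show ?thesis unfolding m by simp
qed

lemma monomial_in_eigenspace:
  assumes "\<alpha> > -1"
  shows "L2_class \<alpha> (\<lambda>z. z ^ p * cnj z ^ q) \<in> eigenspace \<alpha> (int p - int q)"
proof -
  note m = sq_integrable_monomial[OF assms, of p q]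
  have "rotation \<alpha> \<tau> (L2_class \<alpha> (\<lambda>z. z ^ p * cnj z ^ q)) =
      vscale (L2_disk \<alpha>) (inverse \<tau> powi (int p - int q)) (L2_class \<alpha> (\<lambda>z. z ^ p * cnj z ^ q))"
    if \<tau>: "cmod \<tau> = 1" for \<tau>
  proof -
    have "\<tau> \<noteq> 0" using \<tau> by auto
    have c: "cnj (inverse \<tau>) = \<tau>"
      using cnj_eq_inverse[OF \<tau>] by simp
    have "inverse \<tau> powi (int p - int q) = inverse \<tau> ^ p * \<tau> ^ q"
      using \<open>\<tau> \<noteq> 0\<close> by (simp add: power_int_diff divide_inverse power_inverse)
    then have "(inverse \<tau> * z) ^ p * cnj (inverse \<tau> * z) ^ q =
        inverse \<tau> powi (int p - int q) * (z ^ p * cnj z ^ q)" for z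
      by (simp only: c complex_cnj_mult power_mult_distrib mult_ac)
    then show ?thesis using m \<tau> by (simp add: rotation_L2_class)
  qed
  then show ?thesis using m by (simp add: eigenspace_def)
qed

lemma W_set_subset_eigenspace:
  assumes "\<alpha> > -1" shows "W_set \<alpha> \<xi> \<subseteq> eigenspace \<alpha> \<xi>"
proof -
  have "lin_span (L2_disk \<alpha>) {L2_class \<alpha> (\<lambda>z. z ^ p * cnj z ^ q) | p q :: nat. int p - int q = \<xi>}
      \<subseteq> eigenspace \<alpha> \<xi>"
    using monomial_in_eigenspace[OF assms]
    by (intro L2.lin_span_minimal eigenspace_closed_subspace) auto
  then show ?thesis
    unfolding W_set_def using L2.norm_closure_mono eigenspace_closed_subspace(2) by blast
qed

section \<open>Radial operators\<close>

lemma orthogonal_decomposition_W_set: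
  assumes \<alpha>: "\<alpha> > -1" shows "orthogonal_decomposition (L2_disk \<alpha>) (W_set \<alpha>)"
proof
  fix \<xi> \<eta> :: int
  let ?X = "{L2_class \<alpha> (\<lambda>z. z ^ p * cnj z ^ q) | p q :: nat. int p - int q = \<xi>}"
  have X: "?X \<subseteq> vecs (L2_disk \<alpha>)" using sq_integrable_monomial[OF \<alpha>] by auto
  note S = L2.lin_subspace_lin_span[OF X]
  then show "lin_subspace (L2_disk \<alpha>) (W_set \<alpha> \<xi>)"
    unfolding W_set_def by (rule L2.lin_subspace_norm_closure)
  show "norm_closure (L2_disk \<alpha>) (W_set \<alpha> \<xi>) \<subseteq> W_set \<alpha> \<xi>"
    unfolding W_set_def by (rule L2.norm_closure_idem) (use S in \<open>simp add: lin_subspace_def\<close>)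
  show "vinner (L2_disk \<alpha>) x y = 0" if "\<xi> \<noteq> \<eta>" "x \<in> W_set \<alpha> \<xi>" "y \<in> W_set \<alpha> \<eta>" for x y
    using that eigenspace_orthogonal W_set_subset_eigenspace[OF \<alpha>] by blast
next
  fix A assume A: "A \<in> vecs (L2_disk \<alpha>)"
    and orth: "\<And>\<xi> w. w \<in> W_set \<alpha> \<xi> \<Longrightarrow> vinner (L2_disk \<alpha>) A w = 0"
  obtain f where f: "f \<in> sq_integrable \<alpha>" "A = L2_class \<alpha> f" using L2_vecsE[OF A] .
  have "AE z in disk_measure \<alpha>. f z = 0"
  proof (rule AE_eq_0_of_moments)
    \<comment> \<open>Integrability comes from pairing f with the constant monomial, p = q =
      0.\<close>
    show "integrable (disk_measure \<alpha>) f"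
      using integrable_inner[OF f(1) sq_integrable_monomial[OF \<alpha>, of 0 0]] by simp
    fix p q :: nat
    \<comment> \<open>p and q trade places because the inner product conjugates its second argument:
      the moment of z^p cnj z^q is the pairing with z^q cnj z^p.\<close>
    let ?X = "{L2_class \<alpha> (\<lambda>z. z ^ p' * cnj z ^ q') | p' q' :: nat. int p' - int q' = int q - int p}"
    have X: "?X \<subseteq> vecs (L2_disk \<alpha>)" using sq_integrable_monomial[OF \<alpha>] by auto
    have "lin_span (L2_disk \<alpha>) ?X \<subseteq> vecs (L2_disk \<alpha>)"
      using L2.lin_subspace_lin_span[OF X] by (simp add: lin_subspace_def)
    then have "?X \<subseteq> W_set \<alpha> (int q - int p)"
      unfolding W_set_def by (rule order_trans[OF L2.lin_span_superset L2.norm_closure_superset])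
    then have "L2_class \<alpha> (\<lambda>z. z ^ q * cnj z ^ p) \<in> W_set \<alpha> (int q - int p)" by blast
    from orth[OF this] show "(LINT z|disk_measure \<alpha>. f z * (z ^ p * cnj z ^ q)) = 0"
      using f sq_integrable_monomial[OF \<alpha>] by (simp add: mult.commute)
  qed
  then show "A = vzero (L2_disk \<alpha>)" using f by (simp add: vzero_L2_class L2_class_eq_iff)
qed

theorem proposition7p7:
  fixes \<alpha> :: real
  assumes "\<alpha> > -1"
  shows "von_neumann_algebra (L2_disk \<alpha>) (radial_ops \<alpha>) \<and>
    radial_ops \<alpha> =
      {S \<in> bounded_ops (L2_disk \<alpha>). \<forall>\<xi>::int. S ` W_set \<alpha> \<xi> \<subseteq> W_set \<alpha> \<xi>} \<and>
    isometric_star_iso (radial_algebra \<alpha>)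
      (direct_sum (\<lambda>\<xi>::int. operator_algebra (W_space \<alpha> \<xi>))) \<noteq> {}"
proof -
  let ?H = "L2_disk \<alpha>"
  interpret D: orthogonal_decomposition ?H "W_set \<alpha>"
    by (rule orthogonal_decomposition_W_set[OF assms])
  have W_eq: "W_set \<alpha> \<xi> = eigenspace \<alpha> \<xi>" for \<xi>
  proof
    show "eigenspace \<alpha> \<xi> \<subseteq> W_set \<alpha> \<xi>"
    proof
      fix A assume A: "A \<in> eigenspace \<alpha> \<xi>"
      show "A \<in> W_set \<alpha> \<xi>"
      proof (rule D.mem_W_I)
        show "A \<in> vecs ?H" using A by (simp add: eigenspace_def)
        fix \<eta> w assume "\<eta> \<noteq> \<xi>" "w \<in> W_set \<alpha> \<eta>"
        then show "vinner ?H A w = 0"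
          using eigenspace_orthogonal[of \<xi> \<eta> A \<alpha> w] A W_set_subset_eigenspace[OF assms] by blast
      qed
    qed
  qed (rule W_set_subset_eigenspace[OF assms])
  have commutant: "radial_ops \<alpha> = commutant ?H (rotation \<alpha> ` sphere 0 1)"
    by (auto simp: radial_ops_def commutant_def)
  have invariant: "radial_ops \<alpha> = D.invariant_ops"
  proof (intro equalityI subsetI)
    fix S assume "S \<in> radial_ops \<alpha>"
    then have S: "S \<in> bounded_ops ?H"
      and comm: "\<And>\<tau>. cmod \<tau> = 1 \<Longrightarrow> compose (vecs ?H) (rotation \<alpha> \<tau>) S = compose (vecs ?H) S (rotation \<alpha> \<tau>)"
      by (auto simp: radial_ops_def)
    have "S A \<in> eigenspace \<alpha> \<xi>" if A: "A \<in> eigenspace \<alpha> \<xi>" for A \<xi>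
    proof -
      have AV: "A \<in> vecs ?H" using A by (simp add: eigenspace_def)
      have "rotation \<alpha> \<tau> (S A) = vscale ?H (inverse \<tau> powi \<xi>) (S A)" if \<tau>: "cmod \<tau> = 1" for \<tau>
      proof -
        have "rotation \<alpha> \<tau> (S A) = S (rotation \<alpha> \<tau> A)"
          using fun_cong[OF comm[OF \<tau>], of A] AV by (simp add: compose_def)
        also have "rotation \<alpha> \<tau> A = vscale ?H (inverse \<tau> powi \<xi>) A"
          using A \<tau> by (simp add: eigenspace_def)
        finally show ?thesis using S AV by (simp add: L2.bounded_ops_scale)
      qed
      then show ?thesis using S AV by (simp add: eigenspace_def)
    qed
    with S show "S \<in> D.invariant_ops" by (auto simp: D.invariant_ops_def W_eq)
  next
    fix S assume S: "S \<in> D.invariant_ops"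
    note Sb = D.invariant_opsD(1)[OF S]
    have "compose (vecs ?H) (rotation \<alpha> \<tau>) S = compose (vecs ?H) S (rotation \<alpha> \<tau>)" if \<tau>: "cmod \<tau> = 1" for \<tau>
    \<comment> \<open>Both compositions are bounded, so comparing them on the blocks suffices; there
      the rotation is multiplication by a scalar.\<close>
    proof (rule D.bounded_ops_eq_on_W)
      fix \<xi> A assume A: "A \<in> W_set \<alpha> \<xi>"
      have AV: "A \<in> vecs ?H" using A by simp
      have eigen: "rotation \<alpha> \<tau> B = vscale ?H (inverse \<tau> powi \<xi>) B" if "B \<in> W_set \<alpha> \<xi>" for B
        using that \<tau> unfolding W_eq eigenspace_def by blast
      have "rotation \<alpha> \<tau> (S A) = S (rotation \<alpha> \<tau> A)"
        using eigen[OF A] eigen[OF D.invariant_opsD(2)[OF S A]] L2.bounded_ops_scale[OF Sb AV] by metis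
      then show "compose (vecs ?H) (rotation \<alpha> \<tau>) S A = compose (vecs ?H) S (rotation \<alpha> \<tau>) A"
        using AV by (simp only: compose_def restrict_apply if_True)
    qed (use Sb \<tau> in \<open>auto intro: L2.compose_bounded_ops rotation_bounded\<close>)
    with Sb show "S \<in> radial_ops \<alpha>" by (simp add: radial_ops_def)
  qed
  have "von_neumann_algebra ?H (radial_ops \<alpha>)"
    unfolding commutant
  proof (rule L2.von_neumann_algebra_commutant)
    show "rotation \<alpha> ` sphere 0 1 \<subseteq> bounded_ops ?H" by (auto intro: rotation_bounded)
    \<comment> \<open>Closure under adjoints is read off from the description by invariant blocks
      rather than from the rotations.\<close>
    show "adjoint_op ?H S \<in> commutant ?H (rotation \<alpha> ` sphere 0 1)"
      if "S \<in> commutant ?H (rotation \<alpha> ` sphere 0 1)" for S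
      using that D.adjoint_invariant by (simp flip: commutant add: invariant)
  qed
  moreover have "D.blocks \<in> isometric_star_iso (radial_algebra \<alpha>)
      (direct_sum (\<lambda>\<xi>::int. operator_algebra (W_space \<alpha> \<xi>)))"
    using D.blocks_isometric_star_iso by (simp add: radial_algebra_def invariant W_space_def)
  ultimately show ?thesis
    using invariant by (auto simp: D.invariant_ops_def)
qed

end
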